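(* Let $k$ be a unital commutative ring and let $A$ be an augmented, commutative $k$-algebra with augmentation ideal $I$. Let $M$ be a symmetric $A$-bimodule which is flat over $k$. Let \[i\colon C\Gamma_{\star}\left(I,M\right)\rightarrow C\Gamma_{\star}\left(A,M\right)\] denote the inclusion of the subcomplex, and let $P_\star\colon C\Gamma_\star(A,M)\to C\Gamma_\star(I,M)$ be the pruning map. The composite \[P_{\star}\circ i\colon C\Gamma_{\star}(I,M)\rightarrow C\Gamma_{\star}(I,M)\] is the identity map.
   Context: All tensor products are over $k$. $A$ is augmented by a $k$-algebra homomorphism $\varepsilon\colon A\to k$, $I=\mathrm{Ker}(\varepsilon)$, and $A\cong I\oplus k$ as $k$-modules. A bimodule $M$ is symmetric if $am=ma$. Let $\Omega$ be the category with objects $\underline{n}=\{1,\dots,n\}$, $n\geqslant1$, and morphisms surjections. $N\Omega_n(\underline{x},\underline{1})$ is the set of strings $[f_n\mid\cdots\mid f_1]$ of composable morphisms $\underline{x}\xrightarrow{f_1}\underline{x_1}\xrightarrow{f_2}\cdots\xrightarrow{f_{n-1}}\underline{x_{n-1}}\xrightarrow{f_n}\underline{1}$ in $\Omega$. For $i\in\underline{x_{n-1}}$ the $i$-th component $[f_{n-1}^i\mid\cdots\mid f_1^i]$ is the string of morphisms obtained by restricting to the iterated preimages of $i$, re-indexed in order-preserving fashion so that the domain of the $j$-th morphism is $\underline{c}$ with $c=|f_j^{-1}\cdots f_{n-1}^{-1}(i)|$ and the final codomain is $\underline{1}$. A surjection $f\colon\underline{x}\to\underline{x_1}$ induces $f_\star\colon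 A^{\otimes x}\to A^{\otimes x_1}$ whose $j$-th output factor is the product of the $a_l$ with $f(l)=j$. Robinson–Whitehouse complex: $C\Gamma_0(A,M)=A\otimes M$ and $C\Gamma_n(A,M)=\bigoplus_{x\geqslant1}k[N\Omega_n(\underline{x},\underline{1})]\otimes A^{\otimes x}\otimes M$. It is a simplicial $k$-module, with face maps on $X=[f_n\mid\cdots\mid f_1]\otimes(a_1\otimes\cdots\otimes a_x)\otimes m$ given by $\partial_0(X)=[f_n\mid\cdots\mid f_2]\otimes f_{1\star}(a_1\otimes\cdots\otimes a_x)\otimes m$; $\partial_j(X)=[f_n\mid\cdots\mid f_{j+1}\circ f_j\mid\cdots\mid f_1]\otimes(a_1\otimes\cdots\otimes a_x)\otimes m$ for $1\leqslant j\leqslant n-1$; and $\partial_n(X)=\sum_{i\in\underline{x_{n-1}}}[f_{n-1}^i\mid\cdots\mid f_1^i]\otimes(a_{i_1}\otimes\cdots\otimes a_{i_r})\otimes\big(\prod_{j\notin f_1^{-1}\cdots f_{n-1}^{-1}(i)}a_j\big)m$, where $\{i_1<\cdots<i_r\}$ is the preimage of $i$ under $f_{n-1}\circ\cdots\circ f_1$; degeneracies insert identity morphisms. $C\Gamma_\star(A,M)$ also denotes the associated chain complex. $C\Gamma_\star(I,M)$ is the subcomplex $C\Gamma_n(I,M)=\bigoplus_{x\geqslant1}k[N\Omega_n(\underline{x},\underline{1})]\otimes I^{\otimes x}\otimes M$ with the induced boundary. Pruning map: a basic tensor in $A^{\otimes x}$ is an elementary tensor in which each factor is either in $I$ (non-trivial)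 or equal to $1_k$ (trivial); such tensors generate $A^{\otimes x}$ over $k$. For a generator $[f_n\mid\cdots\mid f_1]\otimes(a_1\otimes\cdots\otimes a_x)\otimes m$ with $a_1\otimes\cdots\otimes a_x$ basic, let $L=\{l_1<\cdots<l_h\}$ be the set of indices of the non-trivial factors, and let $m_i=\mathrm{Im}((f_i\circ\cdots\circ f_1)|_L)$. Let $\widetilde{f_1}\colon\underline{|L|}\to\underline{|m_1|}$ be $f_1$ restricted to domain $L$ and codomain $m_1$, and for $2\leqslant i\leqslant n$ let $\widetilde{f_i}\colon\underline{|m_{i-1}|}\to\underline{|m_i|}$ be $f_i$ restricted to domain $m_{i-1}$ and codomain $m_i$, all re-indexed in the canonical (order-preserving) way. The pruning map $P_\star\colon C\Gamma_\star(A,M)\to C\Gamma_\star(I,M)$ is the $k$-linear chain map determined by $[f_n\mid\cdots\mid f_1]\otimes(a_1\otimes\cdots\otimes a_x)\otimes m\mapsto[\widetilde{f_n}\mid\cdots\mid\widetilde{f_1}]\otimes(a_{l_1}\otimes\cdots\otimes a_{l_h})\otimes m$, and such a generator is sent to $0$ when $L=\emptyset$. *)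

theory Defs
  imports "HOL-Algebra.QuotRing" "HOL-Algebra.Module"
begin

section \<open>Linear algebra over a commutative ring\<close>

definition linear_maps :: "'k ring \<Rightarrow> ('k, 'b) module \<Rightarrow> ('k, 'c) module \<Rightarrow> ('b \<Rightarrow> 'c) set"
  where "linear_maps k N N' =
    {F \<in> carrier N \<rightarrow>\<^sub>E carrier N'.
       (\<forall>u\<in>carrier N. \<forall>v\<in>carrier N. F (u \<oplus>\<^bsub>N\<^esub> v) = F u \<oplus>\<^bsub>N'\<^esub> F v) \<and>
       (\<forall>c\<in>carrier k. \<forall>u\<in>carrier N. F (c \<odot>\<^bsub>N\<^esub> u) = c \<odot>\<^bsub>N'\<^esub> F u)}"

text \<open>
  The \<open>k\<close>-linear map determined by prescribing the value \<open>val s\<close> on the element \<open>gen s\<close>,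
  for \<open>s\<close> in an index set \<open>S\<close> such that the \<open>gen s\<close> generate \<open>N\<close>.
\<close>

definition linear_extension ::
    "'k ring \<Rightarrow> ('k, 'b) module \<Rightarrow> ('k, 'c) module \<Rightarrow> 's set \<Rightarrow> ('s \<Rightarrow> 'b) \<Rightarrow> ('s \<Rightarrow> 'c) \<Rightarrow> 'b \<Rightarrow> 'c"
  where "linear_extension k N N' S gen val =
    (THE F. F \<in> linear_maps k N N' \<and> (\<forall>s\<in>S. F (gen s) = val s))"

text \<open>
  Modules are HOL-Algebra records extending rings; the ring fields \<open>mult\<close> and \<open>one\<close> play no
  role for a module and are left undefined.
\<close>

definition regular_module :: "'k ring \<Rightarrow> ('k, 'k) module"
  where "regular_module k =
    \<lparr>carrier = carrier k, mult = undefined, one = undefined,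
     zero = zero k, add = add k, smult = mult k\<rparr>"

definition direct_sum :: "'s set \<Rightarrow> ('s \<Rightarrow> ('k, 'b) module) \<Rightarrow> ('k, 's \<Rightarrow> 'b) module"
  where "direct_sum S N =
    \<lparr>carrier = {u \<in> (\<Pi>\<^sub>E s\<in>S. carrier (N s)). finite {s \<in> S. u s \<noteq> \<zero>\<^bsub>N s\<^esub>}},
     mult = undefined, one = undefined,
     zero = (\<lambda>s\<in>S. \<zero>\<^bsub>N s\<^esub>),
     add = (\<lambda>u v. \<lambda>s\<in>S. u s \<oplus>\<^bsub>N s\<^esub> v s),
     smult = (\<lambda>c u. \<lambda>s\<in>S. c \<odot>\<^bsub>N s\<^esub> u s)\<rparr>"

definition direct_sum_incl :: "'s set \<Rightarrow> ('s \<Rightarrow> ('k, 'b) module) \<Rightarrow> 's \<Rightarrow> 'b \<Rightarrow> 's \<Rightarrow> 'b"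
  where "direct_sum_incl S N t u = (\<lambda>s\<in>S. if s = t then u else \<zero>\<^bsub>N s\<^esub>)"

definition free_module :: "'k ring \<Rightarrow> 's set \<Rightarrow> ('k, 's \<Rightarrow> 'k) module"
  where "free_module k S = direct_sum S (\<lambda>_. regular_module k)"

definition free_basis :: "'k ring \<Rightarrow> 's set \<Rightarrow> 's \<Rightarrow> 's \<Rightarrow> 'k"
  where "free_basis k S s = direct_sum_incl S (\<lambda>_. regular_module k) s \<one>\<^bsub>k\<^esub>"

definition submodule_span :: "'k ring \<Rightarrow> ('k, 'b) module \<Rightarrow> 'b set \<Rightarrow> 'b set"
  where "submodule_span k N S = \<Inter>{U. submodule U k N \<and> S \<subseteq> U}"

definition quotient_module :: "('k, 'b) module \<Rightarrow> 'b set \<Rightarrow> ('k, 'b set) module"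
  where "quotient_module N U =
    \<lparr>carrier = a_rcosets\<^bsub>N\<^esub> U, mult = undefined, one = undefined,
     zero = U, add = set_add N,
     smult = (\<lambda>c X. \<Union>u\<in>X. U +>\<^bsub>N\<^esub> (c \<odot>\<^bsub>N\<^esub> u))\<rparr>"


subsection \<open>Tensor products\<close>

definition tensor_relations ::
    "'k ring \<Rightarrow> ('k, 'b) module \<Rightarrow> ('k, 'c) module \<Rightarrow> ('b \<times> 'c \<Rightarrow> 'k) set"
  where "tensor_relations k N N' =
    (let S = carrier N \<times> carrier N'; F = free_module k S; e = free_basis k S in
       {e (u \<oplus>\<^bsub>N\<^esub> v, w) \<ominus>\<^bsub>F\<^esub> (e (u, w) \<oplus>\<^bsub>F\<^esub> e (v, w)) | u v w.
          u \<in> carrier N \<and> v \<in> carrier N \<and> w \<in> carrier N'} \<union>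
       {e (u, v \<oplus>\<^bsub>N'\<^esub> w) \<ominus>\<^bsub>F\<^esub> (e (u, v) \<oplus>\<^bsub>F\<^esub> e (u, w)) | u v w.
          u \<in> carrier N \<and> v \<in> carrier N' \<and> w \<in> carrier N'} \<union>
       {e (c \<odot>\<^bsub>N\<^esub> u, w) \<ominus>\<^bsub>F\<^esub> c \<odot>\<^bsub>F\<^esub> e (u, w) | c u w.
          c \<in> carrier k \<and> u \<in> carrier N \<and> w \<in> carrier N'} \<union>
       {e (u, c \<odot>\<^bsub>N'\<^esub> w) \<ominus>\<^bsub>F\<^esub> c \<odot>\<^bsub>F\<^esub> e (u, w) | c u w.
          c \<in> carrier k \<and> u \<in> carrier N \<and> w \<in> carrier N'})"

definition tensor_product ::
    "'k ring \<Rightarrow> ('k, 'b) module \<Rightarrow> ('k, 'c) module \<Rightarrow> ('k, ('b \<times> 'c \<Rightarrow> 'k) set) module"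
  where "tensor_product k N N' =
    (let F = free_module k (carrier N \<times> carrier N')
     in quotient_module F (submodule_span k F (tensor_relations k N N')))"

definition pure_tensor ::
    "'k ring \<Rightarrow> ('k, 'b) module \<Rightarrow> ('k, 'c) module \<Rightarrow> 'b \<Rightarrow> 'c \<Rightarrow> ('b \<times> 'c \<Rightarrow> 'k) set"
  where "pure_tensor k N N' u w =
    (let S = carrier N \<times> carrier N'; F = free_module k S
     in submodule_span k F (tensor_relations k N N') +>\<^bsub>F\<^esub> free_basis k S (u, w))"

text \<open>
  The \<open>x\<close>-fold tensor power: the list \<open>[a\<^sub>1, \<dots>, a\<^sub>x]\<close> indexes the generator
  \<open>a\<^sub>1 \<otimes> \<dots> \<otimes> a\<^sub>x\<close>.
\<close>

definition tuples :: "('k, 'a) module \<Rightarrow> nat \<Rightarrow> 'a list set"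
  where "tuples N x = {as. length as = x \<and> set as \<subseteq> carrier N}"

definition power_relations :: "'k ring \<Rightarrow> ('k, 'a) module \<Rightarrow> nat \<Rightarrow> ('a list \<Rightarrow> 'k) set"
  where "power_relations k N x =
    (let S = tuples N x; F = free_module k S; e = free_basis k S in
       {e (as[i := a \<oplus>\<^bsub>N\<^esub> b]) \<ominus>\<^bsub>F\<^esub> (e (as[i := a]) \<oplus>\<^bsub>F\<^esub> e (as[i := b])) | as i a b.
          as \<in> S \<and> i < x \<and> a \<in> carrier N \<and> b \<in> carrier N} \<union>
       {e (as[i := c \<odot>\<^bsub>N\<^esub> a]) \<ominus>\<^bsub>F\<^esub> c \<odot>\<^bsub>F\<^esub> e (as[i := a]) | as i c a.
          as \<in> S \<and> i < x \<and> c \<in> carrier k \<and> a \<in> carrier N})"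

definition tensor_power :: "'k ring \<Rightarrow> ('k, 'a) module \<Rightarrow> nat \<Rightarrow> ('k, ('a list \<Rightarrow> 'k) set) module"
  where "tensor_power k N x =
    (let F = free_module k (tuples N x)
     in quotient_module F (submodule_span k F (power_relations k N x)))"

definition power_tensor :: "'k ring \<Rightarrow> ('k, 'a) module \<Rightarrow> 'a list \<Rightarrow> ('a list \<Rightarrow> 'k) set"
  where "power_tensor k N as =
    (let S = tuples N (length as); F = free_module k S
     in submodule_span k F (power_relations k N (length as)) +>\<^bsub>F\<^esub> free_basis k S as)"


subsection \<open>Flatness\<close>

definition tensor_map_left ::
    "'k ring \<Rightarrow> ('k, 'b) module \<Rightarrow> ('k, 'c) module \<Rightarrow> ('k, 'm) module \<Rightarrow> ('b \<Rightarrow> 'c)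
      \<Rightarrow> ('b \<times> 'm \<Rightarrow> 'k) set \<Rightarrow> ('c \<times> 'm \<Rightarrow> 'k) set"
  where "tensor_map_left k N N' M f =
    linear_extension k (tensor_product k N M) (tensor_product k N' M) (carrier N \<times> carrier M)
      (\<lambda>(u, m). pure_tensor k N M u m) (\<lambda>(u, m). pure_tensor k N' M (f u) m)"

text \<open>
  Tensoring with \<open>M\<close> preserves injectivity of linear maps.  HOL cannot quantify over all
  carrier types here.  The type \<open>(nat \<Rightarrow> 'k) set\<close> contains, up to isomorphism, all
  countably generated modules (cosets in \<open>k\<^sup>(\<^sup>\<nat>\<^sup>)\<close>) and their submodules, in particular the
  inclusions \<open>J \<subseteq> k\<close> of ideals, so by the ideal
  criterion for flatness nothing is lost by the restriction.
\<close>

definition flat_module :: "'k ring \<Rightarrow> ('k, 'm) module \<Rightarrow> bool"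
  where "flat_module k M \<longleftrightarrow> module k M \<and>
    (\<forall>(N :: ('k, (nat \<Rightarrow> 'k) set) module) (N' :: ('k, (nat \<Rightarrow> 'k) set) module) f.
       module k N \<longrightarrow> module k N' \<longrightarrow> f \<in> linear_maps k N N' \<longrightarrow> inj_on f (carrier N) \<longrightarrow>
       inj_on (tensor_map_left k N N' M f) (carrier (tensor_product k N M)))"


section \<open>Augmented algebras and symmetric bimodules\<close>

locale augmented_algebra = algebra k A
  for k :: "'k ring" and A :: "('k, 'a) module" +
  fixes \<epsilon> :: "'a \<Rightarrow> 'k"
  assumes augmentation_hom: "\<epsilon> \<in> ring_hom A k"
    and augmentation_smult:
      "\<lbrakk>c \<in> carrier k; a \<in> carrier A\<rbrakk> \<Longrightarrow> \<epsilon> (c \<odot>\<^bsub>A\<^esub> a) = c \<otimes>\<^bsub>k\<^esub> \<epsilon> a"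

definition augmentation_ideal :: "'k ring \<Rightarrow> ('k, 'a) module \<Rightarrow> ('a \<Rightarrow> 'k) \<Rightarrow> ('k, 'a) module"
  where "augmentation_ideal k A \<epsilon> = A\<lparr>carrier := a_kernel A k \<epsilon>\<rparr>"

text \<open>
  Bimodules over a \<open>k\<close>-algebra, with \<open>k\<close>-bilinear left action \<open>lact a m = am\<close> and right
  action \<open>ract m a = ma\<close>.
\<close>

locale algebra_bimodule = A: algebra k A + M: module k M
  for k :: "'k ring" and A :: "('k, 'a) module" and M :: "('k, 'm) module" +
  fixes lact :: "'a \<Rightarrow> 'm \<Rightarrow> 'm" and ract :: "'m \<Rightarrow> 'a \<Rightarrow> 'm"
  assumes lact_closed: "\<lbrakk>a \<in> carrier A; m \<in> carrier M\<rbrakk> \<Longrightarrow> lact a m \<in> carrier M"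
    and lact_add_left: "\<lbrakk>a \<in> carrier A; b \<in> carrier A; m \<in> carrier M\<rbrakk> \<Longrightarrow>
          lact (a \<oplus>\<^bsub>A\<^esub> b) m = lact a m \<oplus>\<^bsub>M\<^esub> lact b m"
    and lact_add_right: "\<lbrakk>a \<in> carrier A; m \<in> carrier M; m' \<in> carrier M\<rbrakk> \<Longrightarrow>
          lact a (m \<oplus>\<^bsub>M\<^esub> m') = lact a m \<oplus>\<^bsub>M\<^esub> lact a m'"
    and lact_smult_left: "\<lbrakk>c \<in> carrier k; a \<in> carrier A; m \<in> carrier M\<rbrakk> \<Longrightarrow>
          lact (c \<odot>\<^bsub>A\<^esub> a) m = c \<odot>\<^bsub>M\<^esub> lact a m"
    and lact_smult_right: "\<lbrakk>c \<in> carrier k; a \<in> carrier A; m \<in> carrier M\<rbrakk> \<Longrightarrow>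
          lact a (c \<odot>\<^bsub>M\<^esub> m) = c \<odot>\<^bsub>M\<^esub> lact a m"
    and lact_mult: "\<lbrakk>a \<in> carrier A; b \<in> carrier A; m \<in> carrier M\<rbrakk> \<Longrightarrow>
          lact (a \<otimes>\<^bsub>A\<^esub> b) m = lact a (lact b m)"
    and lact_one: "m \<in> carrier M \<Longrightarrow> lact \<one>\<^bsub>A\<^esub> m = m"
    and ract_closed: "\<lbrakk>a \<in> carrier A; m \<in> carrier M\<rbrakk> \<Longrightarrow> ract m a \<in> carrier M"
    and ract_add_left: "\<lbrakk>a \<in> carrier A; m \<in> carrier M; m' \<in> carrier M\<rbrakk> \<Longrightarrow>
          ract (m \<oplus>\<^bsub>M\<^esub> m') a = ract m a \<oplus>\<^bsub>M\<^esub> ract m' a"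
    and ract_add_right: "\<lbrakk>a \<in> carrier A; b \<in> carrier A; m \<in> carrier M\<rbrakk> \<Longrightarrow>
          ract m (a \<oplus>\<^bsub>A\<^esub> b) = ract m a \<oplus>\<^bsub>M\<^esub> ract m b"
    and ract_smult_left: "\<lbrakk>c \<in> carrier k; a \<in> carrier A; m \<in> carrier M\<rbrakk> \<Longrightarrow>
          ract (c \<odot>\<^bsub>M\<^esub> m) a = c \<odot>\<^bsub>M\<^esub> ract m a"
    and ract_smult_right: "\<lbrakk>c \<in> carrier k; a \<in> carrier A; m \<in> carrier M\<rbrakk> \<Longrightarrow>
          ract m (c \<odot>\<^bsub>A\<^esub> a) = c \<odot>\<^bsub>M\<^esub> ract m a"
    and ract_mult: "\<lbrakk>a \<in> carrier A; b \<in> carrier A; m \<in> carrier M\<rbrakk> \<Longrightarrow>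
          ract m (a \<otimes>\<^bsub>A\<^esub> b) = ract (ract m a) b"
    and ract_one: "m \<in> carrier M \<Longrightarrow> ract m \<one>\<^bsub>A\<^esub> = m"
    and lact_ract: "\<lbrakk>a \<in> carrier A; b \<in> carrier A; m \<in> carrier M\<rbrakk> \<Longrightarrow>
          ract (lact a m) b = lact a (ract m b)"

locale symmetric_bimodule = algebra_bimodule +
  assumes symmetric: "\<lbrakk>a \<in> carrier A; m \<in> carrier M\<rbrakk> \<Longrightarrow> lact a m = ract m a"


section \<open>The category of finite sets and surjections\<close>

definition surjections :: "nat \<Rightarrow> nat \<Rightarrow> (nat \<Rightarrow> nat) set"
  where "surjections x y = {f \<in> {1..x} \<rightarrow>\<^sub>E {1..y}. f ` {1..x} = {1..y}}"

text \<open>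
  The string \<open>[f\<^sub>n | \<dots> | f\<^sub>1]\<close> is the list \<open>[f\<^sub>1, \<dots>, f\<^sub>n]\<close>, in order of application.  The
  codomain of a surjection \<open>f\<close> with domain \<open>{1..x}\<close> is recovered as \<open>{1..card (f ` {1..x})}\<close>,
  so a list together with its initial object determines all the objects in the string.
\<close>

type_synonym string_\<Omega> = "(nat \<Rightarrow> nat) list"

primrec nerve_strings :: "nat \<Rightarrow> nat \<Rightarrow> nat \<Rightarrow> string_\<Omega> set"
  where
    "nerve_strings 0 x z = (if x = z then {[]} else {})"
  | "nerve_strings (Suc n) x z =
       {f # fs | f fs y. 1 \<le> y \<and> f \<in> surjections x y \<and> fs \<in> nerve_strings n y z}"

definition string_obj :: "nat \<Rightarrow> string_\<Omega> \<Rightarrow> nat \<Rightarrow> nat"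
  where "string_obj x fs j = foldl (\<lambda>y f. card (f ` {1..y})) x (take j fs)"

definition string_comp :: "string_\<Omega> \<Rightarrow> nat \<Rightarrow> nat"
  where "string_comp fs l = fold (\<lambda>f a. f a) fs l"

definition string_fibre :: "nat \<Rightarrow> string_\<Omega> \<Rightarrow> nat \<Rightarrow> nat set"
  where "string_fibre x fs i = {l \<in> {1..x}. string_comp fs l = i}"

text \<open>
  \<open>reindex S T f\<close> is the restriction \<open>S \<rightarrow> T\<close> of \<open>f\<close>, transported along the order-preserving
  bijections \<open>{1..card S} \<cong> S\<close> and \<open>T \<cong> {1..card T}\<close>.
\<close>

definition reindex :: "nat set \<Rightarrow> nat set \<Rightarrow> (nat \<Rightarrow> nat) \<Rightarrow> nat \<Rightarrow> nat"
  where "reindex S T f =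
    (\<lambda>j\<in>{1..card S}. card {t \<in> T. t \<le> f (sorted_list_of_set S ! (j - 1))})"

text \<open>
  \<open>component x [f\<^sub>1, \<dots>, f\<^sub>p] i\<close> restricts a string starting at the object \<open>x\<close> to the iterated
  preimages of the element \<open>i\<close> of its final object.
\<close>

primrec component :: "nat \<Rightarrow> string_\<Omega> \<Rightarrow> nat \<Rightarrow> string_\<Omega>"
  where
    "component x [] i = []"
  | "component x (f # fs) i =
       (let y = card (f ` {1..x})
        in reindex (string_fibre x (f # fs) i) (string_fibre y fs i) f # component y fs i)"

primrec prune :: "nat set \<Rightarrow> string_\<Omega> \<Rightarrow> string_\<Omega>"
  where
    "prune L [] = []"
  | "prune L (f # fs) = reindex L (f ` L) f # prune (f ` L) fs"

text \<open>The subtuple of \<open>[a\<^sub>1, \<dots>, a\<^sub>x]\<close> with indices in \<open>L \<subseteq> {1..x}\<close>.\<close>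

definition subtuple :: "nat set \<Rightarrow> 'a list \<Rightarrow> 'a list"
  where "subtuple L as = map (\<lambda>l. as ! (l - 1)) (sorted_list_of_set L)"

definition pushforward :: "('k, 'a) module \<Rightarrow> (nat \<Rightarrow> nat) \<Rightarrow> 'a list \<Rightarrow> 'a list"
  where "pushforward A f as =
    map (\<lambda>j. \<Otimes>\<^bsub>A\<^esub>l\<in>{l \<in> {1..length as}. f l = j}. as ! (l - 1))
      [1..<Suc (card (f ` {1..length as}))]"


section \<open>The Robinson--Whitehouse complex\<close>

text \<open>
  In the following, \<open>B\<close> is either the algebra \<open>A\<close> itself or its augmentation ideal; products
  are always taken in \<open>A\<close>.  Since \<open>nerve_strings 0 x 1\<close> is empty unless \<open>x = 1\<close>, degree 0 is
  \<open>k \<otimes> B \<otimes> M = B \<otimes> M\<close>.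
\<close>

type_synonym ('k, 'a, 'm) rw_summand =
  "((string_\<Omega> \<Rightarrow> 'k) \<times> (('a list \<Rightarrow> 'k) set \<times> 'm \<Rightarrow> 'k) set \<Rightarrow> 'k) set"

type_synonym ('k, 'a, 'm) rw_elem = "nat \<Rightarrow> ('k, 'a, 'm) rw_summand"

type_synonym ('a, 'm) rw_index = "string_\<Omega> \<times> 'a list \<times> 'm"

definition rw_summand ::
    "'k ring \<Rightarrow> ('k, 'a) module \<Rightarrow> ('k, 'm) module \<Rightarrow> nat \<Rightarrow> nat
      \<Rightarrow> ('k, ('k, 'a, 'm) rw_summand) module"
  where "rw_summand k B M n x =
    tensor_product k (free_module k (nerve_strings n x 1))
      (tensor_product k (tensor_power k B x) M)"

definition rw_module ::
    "'k ring \<Rightarrow> ('k, 'a) module \<Rightarrow> ('k, 'm) module \<Rightarrow> nat \<Rightarrow> ('k, ('k, 'a, 'm) rw_elem) module"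
  where "rw_module k B M n = direct_sum {1..} (rw_summand k B M n)"

definition rw_indices :: "('k, 'a) module \<Rightarrow> ('k, 'm) module \<Rightarrow> nat \<Rightarrow> ('a, 'm) rw_index set"
  where "rw_indices B M n =
    {(fs, as, m). 1 \<le> length as \<and> fs \<in> nerve_strings n (length as) 1 \<and>
                  set as \<subseteq> carrier B \<and> m \<in> carrier M}"

text \<open>The generator \<open>[f\<^sub>n | \<dots> | f\<^sub>1] \<otimes> (a\<^sub>1 \<otimes> \<dots> \<otimes> a\<^sub>x) \<otimes> m\<close>.\<close>

definition rw_gen ::
    "'k ring \<Rightarrow> ('k, 'a) module \<Rightarrow> ('k, 'm) module \<Rightarrow> nat \<Rightarrow> ('a, 'm) rw_index
      \<Rightarrow> ('k, 'a, 'm) rw_elem"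
  where "rw_gen k B M n = (\<lambda>(fs, as, m).
    let x = length as; S = nerve_strings n x 1; T = tensor_power k B x in
      direct_sum_incl {1..} (rw_summand k B M n) x
        (pure_tensor k (free_module k S) (tensor_product k T M)
          (free_basis k S fs) (pure_tensor k T M (power_tensor k B as) m)))"

definition inner_face :: "nat \<Rightarrow> nat \<Rightarrow> string_\<Omega> \<Rightarrow> string_\<Omega>"
  where "inner_face x j fs =
    take (j - 1) fs @ compose {1..string_obj x fs (j - 1)} (fs ! j) (fs ! (j - 1)) # drop (j + 1) fs"

text \<open>The value of \<open>\<partial>\<^sub>j\<close>, from degree \<open>n + 1\<close> to degree \<open>n\<close>, on a generator.\<close>

definition rw_face_gen ::
    "'k ring \<Rightarrow> ('k, 'a) module \<Rightarrow> ('k, 'a) module \<Rightarrow> ('k, 'm) module \<Rightarrow> ('a \<Rightarrow> 'm \<Rightarrow> 'm)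
      \<Rightarrow> nat \<Rightarrow> nat \<Rightarrow> ('a, 'm) rw_index \<Rightarrow> ('k, 'a, 'm) rw_elem"
  where "rw_face_gen k A B M lact n j = (\<lambda>(fs, as, m).
    let x = length as in
      if j = 0 then rw_gen k B M n (tl fs, pushforward A (hd fs) as, m)
      else if j \<le> n then rw_gen k B M n (inner_face x j fs, as, m)
      else \<Oplus>\<^bsub>rw_module k B M n\<^esub>i\<in>{1..string_obj x fs n}.
        (let D = string_fibre x (butlast fs) i in
           rw_gen k B M n
             (component x (butlast fs) i, subtuple D as,
              lact (\<Otimes>\<^bsub>A\<^esub>l\<in>{1..x} - D. as ! (l - 1)) m)))"

definition rw_face ::
    "'k ring \<Rightarrow> ('k, 'a) module \<Rightarrow> ('k, 'a) module \<Rightarrow> ('k, 'm) module \<Rightarrow> ('a \<Rightarrow> 'm \<Rightarrow> 'm)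
      \<Rightarrow> nat \<Rightarrow> nat \<Rightarrow> ('k, 'a, 'm) rw_elem \<Rightarrow> ('k, 'a, 'm) rw_elem"
  where "rw_face k A B M lact n j =
    linear_extension k (rw_module k B M (Suc n)) (rw_module k B M n)
      (rw_indices B M (Suc n)) (rw_gen k B M (Suc n)) (rw_face_gen k A B M lact n j)"

text \<open>\<open>chain_boundary C n\<close> is the boundary map from degree \<open>n + 1\<close> to degree \<open>n\<close>.\<close>

record ('k, 'c) chain_complex =
  chain_module :: "nat \<Rightarrow> ('k, 'c) module"
  chain_boundary :: "nat \<Rightarrow> 'c \<Rightarrow> 'c"

definition rw_complex ::
    "'k ring \<Rightarrow> ('k, 'a) module \<Rightarrow> ('k, 'a) module \<Rightarrow> ('k, 'm) module \<Rightarrow> ('a \<Rightarrow> 'm \<Rightarrow> 'm)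
      \<Rightarrow> ('k, ('k, 'a, 'm) rw_elem) chain_complex"
  where "rw_complex k A B M lact =
    \<lparr>chain_module = rw_module k B M,
     chain_boundary = (\<lambda>n. \<lambda>X\<in>carrier (rw_module k B M (Suc n)).
       \<Oplus>\<^bsub>rw_module k B M n\<^esub>j\<in>{0..Suc n}.
         (if even j then rw_face k A B M lact n j X
          else \<ominus>\<^bsub>rw_module k B M n\<^esub> rw_face k A B M lact n j X))\<rparr>"

definition chain_id :: "('k, 'c) chain_complex \<Rightarrow> nat \<Rightarrow> 'c \<Rightarrow> 'c"
  where "chain_id C = (\<lambda>n. \<lambda>X\<in>carrier (chain_module C n). X)"

definition chain_comp ::
    "('k, 'b) chain_complex \<Rightarrow> (nat \<Rightarrow> 'c \<Rightarrow> 'd) \<Rightarrow> (nat \<Rightarrow> 'b \<Rightarrow> 'c) \<Rightarrow> nat \<Rightarrow> 'b \<Rightarrow> 'd"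
  where "chain_comp C G F = (\<lambda>n. compose (carrier (chain_module C n)) (G n) (F n))"


subsection \<open>Inclusion and pruning\<close>

text \<open>The map induced by the inclusions of the tensor powers of \<open>I\<close> into those of \<open>A\<close>.\<close>

definition rw_inclusion ::
    "'k ring \<Rightarrow> ('k, 'a) module \<Rightarrow> ('a \<Rightarrow> 'k) \<Rightarrow> ('k, 'm) module
      \<Rightarrow> nat \<Rightarrow> ('k, 'a, 'm) rw_elem \<Rightarrow> ('k, 'a, 'm) rw_elem"
  where "rw_inclusion k A \<epsilon> M n =
    (let I = augmentation_ideal k A \<epsilon> in
       linear_extension k (rw_module k I M n) (rw_module k A M n)
         (rw_indices I M n) (rw_gen k I M n) (rw_gen k A M n))"

definition basic_indices ::
    "'k ring \<Rightarrow> ('k, 'a) module \<Rightarrow> ('a \<Rightarrow> 'k) \<Rightarrow> ('k, 'm) module \<Rightarrow> nat \<Rightarrow> ('a, 'm) rw_index set"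
  where "basic_indices k A \<epsilon> M n =
    {(fs, as, m) \<in> rw_indices A M n.
       \<forall>a\<in>set as. a \<in> carrier (augmentation_ideal k A \<epsilon>) \<or> a = \<one>\<^bsub>A\<^esub>}"

definition pruning_gen ::
    "'k ring \<Rightarrow> ('k, 'a) module \<Rightarrow> ('a \<Rightarrow> 'k) \<Rightarrow> ('k, 'm) module \<Rightarrow> nat
      \<Rightarrow> ('a, 'm) rw_index \<Rightarrow> ('k, 'a, 'm) rw_elem"
  where "pruning_gen k A \<epsilon> M n = (\<lambda>(fs, as, m).
    let I = augmentation_ideal k A \<epsilon>;
        L = {l \<in> {1..length as}. as ! (l - 1) \<in> carrier I}
    in if L = {} then \<zero>\<^bsub>rw_module k I M n\<^esub>
       else rw_gen k I M n (prune L fs, subtuple L as, m))"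

text \<open>
  Basic tensors generate, so linearity and the values on them already determine the pruning
  map; compatibility with the boundary maps is then a property of it rather than part of its
  definition.
\<close>

definition pruning_map ::
    "'k ring \<Rightarrow> ('k, 'a) module \<Rightarrow> ('a \<Rightarrow> 'k) \<Rightarrow> ('k, 'm) module
      \<Rightarrow> nat \<Rightarrow> ('k, 'a, 'm) rw_elem \<Rightarrow> ('k, 'a, 'm) rw_elem"
  where "pruning_map k A \<epsilon> M n =
    linear_extension k (rw_module k A M n) (rw_module k (augmentation_ideal k A \<epsilon>) M n)
      (basic_indices k A \<epsilon> M n) (rw_gen k A M n) (pruning_gen k A \<epsilon> M n)"

end

theory Submission
  imports Defs
begin

text \<open>
  The inclusion sends a generator \<open>[f\<^sub>n | \<dots> | f\<^sub>1] \<otimes> (a\<^sub>1 \<otimes> \<dots> \<otimes> a\<^sub>x) \<otimes> m\<close> with all \<open>a\<^sub>i \<in> I\<close> to the generator of the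
  same name, and all its tensor factors are non-trivial.  Pruning therefore keeps every factor, and
  restricting surjections to all of their domain and codomain changes nothing
  (\<open>prune_full\<close>, \<open>pruning_gen_ideal\<close>).  So the composite fixes the generators, and it is linear.

  What has to be shown is that both maps exist.  Each is described as the linear map with prescribed
  values on generators (\<^const>\<open>linear_extension\<close>), and such a description says something only if
  the values respect all relations between the generators and if these generate the module.  The
  first sections provide this for modules built from free modules by quotients, tensor products and
  direct sums; the outcome is \<open>rw_lift\<close>, by which a family of maps indexed by strings and multilinear
  in \<open>(a\<^sub>1, \<dots>, a\<^sub>x, m)\<close> extends to the module of the complex, and \<open>rw_gen_generates\<close>.

  For the pruning map the values are given on basic tensors only, by distinguishing factors in \<open>I\<close> from
  factors equal to \<open>1\<close>, so there is no multilinear map to begin with.  The existence proof replaces the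
  case distinction by a formula for arbitrary tensors.  Splitting each factor as \<open>a = (a - \<epsilon>(a)1) + \<epsilon>(a)1\<close> and expanding leads to
  the sum, over all nonempty sets \<open>L \<subseteq> {1, \<dots>, x}\<close>, of the product of the scalars \<open>\<epsilon>(a\<^sub>l)\<close> for \<open>l \<notin> L\<close> times the
  generator with factors \<open>a\<^sub>l - \<epsilon>(a\<^sub>l)1\<close> for \<open>l \<in> L\<close>,
  where the string is pruned along \<open>L\<close>.  Every summand is multilinear (\<open>pruning_term_multilinear\<close>), and on
  a basic tensor all summands vanish except the one that prunes the trivial factors
  (\<open>pruning_terms_basic\<close>).
\<close>

section \<open>Linear maps and generating sets\<close>

text \<open>
  Membership in \<^const>\<open>linear_maps\<close> without extensionality, so that maps can be composed and added
  without restricting them to carriers in between.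
\<close>

definition k_linear :: "'k ring \<Rightarrow> ('k, 'b) module \<Rightarrow> ('k, 'c) module \<Rightarrow> ('b \<Rightarrow> 'c) \<Rightarrow> bool"
  where "k_linear k N N' F \<longleftrightarrow>
    (\<forall>u\<in>carrier N. F u \<in> carrier N') \<and>
    (\<forall>u\<in>carrier N. \<forall>v\<in>carrier N. F (u \<oplus>\<^bsub>N\<^esub> v) = F u \<oplus>\<^bsub>N'\<^esub> F v) \<and>
    (\<forall>c\<in>carrier k. \<forall>u\<in>carrier N. F (c \<odot>\<^bsub>N\<^esub> u) = c \<odot>\<^bsub>N'\<^esub> F u)"

lemma k_linearI:
  assumes "\<And>u. u \<in> carrier N \<Longrightarrow> F u \<in> carrier N'"
    and "\<And>u v. \<lbrakk>u \<in> carrier N; v \<in> carrier N\<rbrakk> \<Longrightarrow> F (u \<oplus>\<^bsub>N\<^esub> v) = F u \<oplus>\<^bsub>N'\<^esub> F v"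
    and "\<And>c u. \<lbrakk>c \<in> carrier k; u \<in> carrier N\<rbrakk> \<Longrightarrow> F (c \<odot>\<^bsub>N\<^esub> u) = c \<odot>\<^bsub>N'\<^esub> F u"
  shows "k_linear k N N' F"
  using assms unfolding k_linear_def by auto

lemma k_linear_closed: "\<lbrakk>k_linear k N N' F; u \<in> carrier N\<rbrakk> \<Longrightarrow> F u \<in> carrier N'"
  and k_linear_add: "\<lbrakk>k_linear k N N' F; u \<in> carrier N; v \<in> carrier N\<rbrakk>
    \<Longrightarrow> F (u \<oplus>\<^bsub>N\<^esub> v) = F u \<oplus>\<^bsub>N'\<^esub> F v"
  and k_linear_smult: "\<lbrakk>k_linear k N N' F; c \<in> carrier k; u \<in> carrier N\<rbrakk>
    \<Longrightarrow> F (c \<odot>\<^bsub>N\<^esub> u) = c \<odot>\<^bsub>N'\<^esub> F u"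
  unfolding k_linear_def by auto

lemma k_linear_cong:
  assumes "k_linear k N N' F" "module k N" "\<And>u. u \<in> carrier N \<Longrightarrow> G u = F u"
  shows "k_linear k N N' G"
proof -
  interpret N: module k N by fact
  show ?thesis using assms(1,3) unfolding k_linear_def by simp
qed

lemma linear_maps_eq: "linear_maps k N N' = {F \<in> extensional (carrier N). k_linear k N N' F}"
  unfolding linear_maps_def k_linear_def PiE_def by auto

lemma restrict_linear_maps:
  assumes "k_linear k N N' F" "module k N"
  shows "restrict F (carrier N) \<in> linear_maps k N N'"
  unfolding linear_maps_eq using k_linear_cong[OF assms, of "restrict F (carrier N)"] by simp

lemma k_linear_zero:
  assumes "k_linear k N N' F" "module k N" "module k N'"
  shows "F \<zero>\<^bsub>N\<^esub> = \<zero>\<^bsub>N'\<^esub>"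
proof -
  interpret N: module k N by fact
  interpret N': module k N' by fact
  have "F \<zero>\<^bsub>N\<^esub> = F (\<zero>\<^bsub>k\<^esub> \<odot>\<^bsub>N\<^esub> \<zero>\<^bsub>N\<^esub>)" by simp
  also have "\<dots> = \<zero>\<^bsub>N'\<^esub>"
    using k_linear_smult[OF assms(1) N.R.zero_closed N.zero_closed]
      k_linear_closed[OF assms(1) N.zero_closed] by simp
  finally show ?thesis .
qed

lemma k_linear_minus:
  assumes "k_linear k N N' F" "module k N" "module k N'" "u \<in> carrier N"
  shows "F (\<ominus>\<^bsub>N\<^esub> u) = \<ominus>\<^bsub>N'\<^esub> F u"
proof -
  interpret N: module k N by fact
  interpret N': module k N' by fact
  have m: "\<ominus>\<^bsub>N\<^esub> u = (\<ominus>\<^bsub>k\<^esub> \<one>\<^bsub>k\<^esub>) \<odot>\<^bsub>N\<^esub> u" using assms(4) by (simp add: N.smult_l_minus)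
  show ?thesis unfolding m
    using assms(4) k_linear_smult[OF assms(1), of "\<ominus>\<^bsub>k\<^esub> \<one>\<^bsub>k\<^esub>" u] k_linear_closed[OF assms(1,4)]
    by (simp add: N'.smult_l_minus)
qed

lemma k_linear_diff:
  assumes "k_linear k N N' F" "module k N" "module k N'" "u \<in> carrier N" "v \<in> carrier N"
  shows "F (u \<ominus>\<^bsub>N\<^esub> v) = F u \<ominus>\<^bsub>N'\<^esub> F v"
proof -
  interpret N: module k N by fact
  show ?thesis using assms k_linear_minus[OF assms(1-3,5)] k_linear_add[OF assms(1,4), of "\<ominus>\<^bsub>N\<^esub> v"]
    by (simp add: a_minus_def)
qed

lemma module_diff_zero:
  assumes "module k N" "u \<in> carrier N" "v \<in> carrier N" "u \<ominus>\<^bsub>N\<^esub> v = \<zero>\<^bsub>N\<^esub>"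
  shows "u = v"
proof -
  interpret N: module k N by fact
  have "u = \<zero>\<^bsub>N\<^esub> \<oplus>\<^bsub>N\<^esub> v"
    using N.add.inv_solve_right[of "\<zero>\<^bsub>N\<^esub>" u v] assms(2-4) by (simp add: a_minus_def)
  then show ?thesis using assms(3) by simp
qed

lemma k_linear_comp:
  assumes "k_linear k N N' F" "k_linear k N' N'' G"
  shows "k_linear k N N'' (\<lambda>u. G (F u))"
  using assms unfolding k_linear_def by auto

lemma k_linear_plus:
  assumes "k_linear k N N' F" "k_linear k N N' G" "module k N'"
  shows "k_linear k N N' (\<lambda>u. F u \<oplus>\<^bsub>N'\<^esub> G u)"
proof -
  interpret N': module k N' by fact
  show ?thesis
    using assms(1,2)
    by (intro k_linearI)
       (auto simp: k_linear_closed k_linear_add k_linear_smult N'.smult_r_distr N'.a_ac)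
qed

lemma k_linear_scale:
  assumes "k_linear k N N' F" "c \<in> carrier k" "module k N'"
  shows "k_linear k N N' (\<lambda>u. c \<odot>\<^bsub>N'\<^esub> F u)"
proof -
  interpret N': module k N' by fact
  show ?thesis
    using assms(1,2)
    by (intro k_linearI)
       (auto simp: k_linear_closed k_linear_add k_linear_smult N'.smult_r_distr
          N'.smult_assoc1[symmetric] N'.R.m_comm)
qed

lemma k_linear_zero_map:
  assumes "module k N'"
  shows "k_linear k N N' (\<lambda>u. \<zero>\<^bsub>N'\<^esub>)"
proof -
  interpret N': module k N' by fact
  show ?thesis by (intro k_linearI) auto
qed

lemma k_linear_finsum_maps:
  assumes "finite J" "\<And>j. j \<in> J \<Longrightarrow> k_linear k N N' (F j)" "module k N" "module k N'"
  shows "k_linear k N N' (\<lambda>u. \<Oplus>\<^bsub>N'\<^esub>j\<in>J. F j u)"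
  using assms(1,2)
proof (induction J rule: finite_induct)
  case empty
  interpret N': module k N' by (rule assms(4))
  show ?case using k_linear_zero_map[OF assms(4)] by simp
next
  case (insert j J)
  interpret N': module k N' by (rule assms(4))
  have "k_linear k N N' (\<lambda>u. F j u \<oplus>\<^bsub>N'\<^esub> (\<Oplus>\<^bsub>N'\<^esub>j\<in>J. F j u))"
    using insert by (intro k_linear_plus assms(4)) auto
  moreover have "(\<Oplus>\<^bsub>N'\<^esub>j\<in>insert j J. F j u) = F j u \<oplus>\<^bsub>N'\<^esub> (\<Oplus>\<^bsub>N'\<^esub>j\<in>J. F j u)" if "u \<in> carrier N" for u
    using insert that by (intro N'.finsum_insert) (auto intro: k_linear_closed)
  ultimately show ?case by (rule k_linear_cong[OF _ assms(3)])
qed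

text \<open>
  A set generates if no proper submodule contains it.  In this form, a property that defines a
  submodule carries over from generators to all elements, and no linear combinations have to be
  written down.
\<close>

definition generates :: "'k ring \<Rightarrow> ('k, 'b) module \<Rightarrow> 'b set \<Rightarrow> bool"
  where "generates k N G \<longleftrightarrow>
    G \<subseteq> carrier N \<and> (\<forall>U. submodule U k N \<longrightarrow> G \<subseteq> U \<longrightarrow> carrier N \<subseteq> U)"

lemma generates_induct:
  assumes "generates k N G" "submodule U k N" "\<And>g. g \<in> G \<Longrightarrow> g \<in> U" "u \<in> carrier N"
  shows "u \<in> U"
  using assms unfolding generates_def by auto

lemma generates_carrier: "generates k N (carrier N)"
  unfolding generates_def by auto

lemma submodule_zero:
  assumes "module k N" "submodule U k N"
  shows "\<zero>\<^bsub>N\<^esub> \<in> U"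
  using subgroup.one_closed[OF submodule.axioms(1)[OF assms(2)]] by simp

lemma submodule_vimage:
  assumes "k_linear k N N' F" "module k N" "module k N'" "submodule U k N'"
  shows "submodule {u \<in> carrier N. F u \<in> U} k N"
proof -
  interpret N: module k N by fact
  interpret N': module k N' by fact
  note U = N'.submoduleE[OF assms(4)]
  note z = submodule_zero[OF assms(3,4)]
  show ?thesis
    by (rule N.submoduleI)
       (use U z in \<open>auto simp: k_linear_zero[OF assms(1-3)] k_linear_minus[OF assms(1-3)]
          k_linear_add[OF assms(1)] k_linear_smult[OF assms(1)]\<close>)
qed

lemma submodule_equalizer:
  assumes "k_linear k N N' F" "k_linear k N N' G" "module k N" "module k N'"
  shows "submodule {u \<in> carrier N. F u = G u} k N"
proof -
  interpret N: module k N by fact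
  interpret N': module k N' by fact
  show ?thesis
    by (rule N.submoduleI)
       (auto simp: k_linear_zero[OF assms(1,3,4)] k_linear_minus[OF assms(1,3,4)]
          k_linear_add[OF assms(1)] k_linear_smult[OF assms(1)]
          k_linear_zero[OF assms(2,3,4)] k_linear_minus[OF assms(2,3,4)]
          k_linear_add[OF assms(2)] k_linear_smult[OF assms(2)])
qed

text \<open>
  Two linear maps agree on a submodule, so agreement on generators is agreement everywhere.
\<close>

lemma k_linear_eqI:
  assumes "k_linear k N N' F" "k_linear k N N' F'" "module k N" "module k N'"
    and "generates k N G" "\<And>g. g \<in> G \<Longrightarrow> F g = F' g" "u \<in> carrier N"
  shows "F u = F' u"
  using generates_induct[OF assms(5) submodule_equalizer[OF assms(1-4)] _ assms(7)] assms(5,6)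
  unfolding generates_def by auto

text \<open>
  A linear map with the prescribed values on generators is the only one, hence it is the one that
  the definite description in \<^const>\<open>linear_extension\<close> picks.  Every use of that constant below
  amounts to constructing such a map.
\<close>

lemma linear_extension_eq:
  assumes "module k N" "module k N'" "generates k N (gen ` S)"
    and "F \<in> linear_maps k N N'" "\<And>s. s \<in> S \<Longrightarrow> F (gen s) = val s"
  shows "linear_extension k N N' S gen val = F"
  unfolding linear_extension_def
proof (rule the_equality)
  show "F \<in> linear_maps k N N' \<and> (\<forall>s\<in>S. F (gen s) = val s)" using assms by auto
next
  fix G assume G: "G \<in> linear_maps k N N' \<and> (\<forall>s\<in>S. G (gen s) = val s)"
  show "G = F"
  proof (rule extensionalityI[of _ "carrier N"])
    fix u assume "u \<in> carrier N"
    moreover have "G g = F g" if "g \<in> gen ` S" for g using G assms(5) that by auto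
    ultimately show "G u = F u"
      using k_linear_eqI[where F = G and F' = F and u = u, OF _ _ assms(1-3)] G assms(4)
      by (auto simp only: linear_maps_eq mem_Collect_eq)
  qed (use G assms(4) in \<open>auto simp: linear_maps_eq\<close>)
qed

section \<open>Direct sums and free modules\<close>

lemma direct_sum_simps:
  "carrier (direct_sum S N) = {u \<in> (\<Pi>\<^sub>E s\<in>S. carrier (N s)). finite {s \<in> S. u s \<noteq> \<zero>\<^bsub>N s\<^esub>}}"
  "\<zero>\<^bsub>direct_sum S N\<^esub> = (\<lambda>s\<in>S. \<zero>\<^bsub>N s\<^esub>)"
  "u \<oplus>\<^bsub>direct_sum S N\<^esub> v = (\<lambda>s\<in>S. u s \<oplus>\<^bsub>N s\<^esub> v s)"
  "c \<odot>\<^bsub>direct_sum S N\<^esub> u = (\<lambda>s\<in>S. c \<odot>\<^bsub>N s\<^esub> u s)"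
  by (simp_all add: direct_sum_def)

lemma direct_sum_module:
  assumes k: "cring k" and N: "\<And>s. s \<in> S \<Longrightarrow> module k (N s)"
  shows "module k (direct_sum S N)"
proof -
  have ag: "abelian_group (N s)" if "s \<in> S" for s using N[OF that] by (rule module.axioms)
  have am: "abelian_monoid (N s)" if "s \<in> S" for s using ag[OF that] by (rule abelian_group.axioms)
  let ?D = "direct_sum S N"
  have add: "u \<oplus>\<^bsub>?D\<^esub> v \<in> carrier ?D" if u: "u \<in> carrier ?D" and v: "v \<in> carrier ?D" for u v
  proof -
    have "{s \<in> S. u s \<oplus>\<^bsub>N s\<^esub> v s \<noteq> \<zero>\<^bsub>N s\<^esub>} \<subseteq> {s \<in> S. u s \<noteq> \<zero>\<^bsub>N s\<^esub>} \<union> {s \<in> S. v s \<noteq> \<zero>\<^bsub>N s\<^esub>}"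
      using abelian_monoid.l_zero[OF am] abelian_monoid.zero_closed[OF am] by auto
    then have "finite {s \<in> S. u s \<oplus>\<^bsub>N s\<^esub> v s \<noteq> \<zero>\<^bsub>N s\<^esub>}"
      by (rule finite_subset) (use u v in \<open>auto simp: direct_sum_simps\<close>)
    then have "finite {s \<in> S. (\<lambda>s\<in>S. u s \<oplus>\<^bsub>N s\<^esub> v s) s \<noteq> \<zero>\<^bsub>N s\<^esub>}"
      by (rule rev_finite_subset) auto
    then show ?thesis
      using u v abelian_monoid.a_closed[OF am] by (auto simp: direct_sum_simps PiE_iff)
  qed
  have smult: "c \<odot>\<^bsub>?D\<^esub> u \<in> carrier ?D" if c: "c \<in> carrier k" and u: "u \<in> carrier ?D" for c u
  proof -
    have "finite {s \<in> S. (\<lambda>s\<in>S. c \<odot>\<^bsub>N s\<^esub> u s) s \<noteq> \<zero>\<^bsub>N s\<^esub>}"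
      by (rule finite_subset[of _ "{s \<in> S. u s \<noteq> \<zero>\<^bsub>N s\<^esub>}"])
         (use u c module.smult_r_null[OF N] in \<open>auto simp: direct_sum_simps\<close>)
    then show ?thesis
      using u c module.smult_closed[OF N] by (auto simp: direct_sum_simps PiE_iff)
  qed
  have zero: "\<zero>\<^bsub>?D\<^esub> \<in> carrier ?D"
  proof -
    have "{s \<in> S. (\<lambda>s\<in>S. \<zero>\<^bsub>N s\<^esub>) s \<noteq> \<zero>\<^bsub>N s\<^esub>} = {}" by auto
    then show ?thesis
      using abelian_monoid.zero_closed[OF am] unfolding direct_sum_simps by (simp add: PiE_iff)
  qed
  have ext: "u = v" if "u \<in> carrier ?D" "v \<in> carrier ?D" "\<And>s. s \<in> S \<Longrightarrow> u s = v s" for u v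
    using that by (intro PiE_ext[of u S "\<lambda>s. carrier (N s)"]) (auto simp: direct_sum_simps)
  have mem: "u s \<in> carrier (N s)" if "u \<in> carrier ?D" "s \<in> S" for u s
    using that by (auto simp: direct_sum_simps)
  have coord: "(u \<oplus>\<^bsub>?D\<^esub> v) s = u s \<oplus>\<^bsub>N s\<^esub> v s" "(c \<odot>\<^bsub>?D\<^esub> u) s = c \<odot>\<^bsub>N s\<^esub> u s"
      "\<zero>\<^bsub>?D\<^esub> s = \<zero>\<^bsub>N s\<^esub>" if "s \<in> S" for u v s c
    using that by (auto simp: direct_sum_simps)
  interpret k: cring k by fact
  show ?thesis
  proof (rule moduleI)
    show "abelian_group ?D"
    proof (rule abelian_groupI)
      fix u assume u: "u \<in> carrier ?D"
      have "(\<ominus>\<^bsub>k\<^esub> \<one>\<^bsub>k\<^esub>) \<odot>\<^bsub>?D\<^esub> u \<oplus>\<^bsub>?D\<^esub> u = \<zero>\<^bsub>?D\<^esub>"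
      proof (rule ext)
        fix s assume s: "s \<in> S"
        interpret Ns: module k "N s" using N[OF s] .
        show "((\<ominus>\<^bsub>k\<^esub> \<one>\<^bsub>k\<^esub>) \<odot>\<^bsub>?D\<^esub> u \<oplus>\<^bsub>?D\<^esub> u) s = \<zero>\<^bsub>?D\<^esub> s"
          using mem[OF u s] by (simp add: coord[OF s] Ns.smult_l_minus Ns.l_neg)
      qed (use u zero add smult in auto)
      then show "\<exists>v\<in>carrier ?D. v \<oplus>\<^bsub>?D\<^esub> u = \<zero>\<^bsub>?D\<^esub>" using u smult by blast
    qed (auto intro!: add zero ext
          simp: coord mem abelian_monoid.a_assoc[OF am] abelian_monoid.a_comm[OF am]
            abelian_monoid.l_zero[OF am])
  qed (auto intro!: k add smult ext
        simp: coord mem module.smult_l_distr[OF N] module.smult_r_distr[OF N]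
          module.smult_assoc1[OF N] module.smult_one[OF N])
qed

lemma direct_sum_incl_linear:
  assumes "\<And>s. s \<in> S \<Longrightarrow> module k (N s)"
  shows "k_linear k (N t) (direct_sum S N) (direct_sum_incl S N t)"
proof (rule k_linearI)
  fix u assume "u \<in> carrier (N t)"
  have "finite {s \<in> S. (\<lambda>s\<in>S. if s = t then u else \<zero>\<^bsub>N s\<^esub>) s \<noteq> \<zero>\<^bsub>N s\<^esub>}"
    by (rule finite_subset[of _ "{t}"]) auto
  then show "direct_sum_incl S N t u \<in> carrier (direct_sum S N)"
    using \<open>u \<in> carrier (N t)\<close> abelian_monoid.zero_closed[OF abelian_group.axioms(1)[OF module.axioms(2)[OF assms]]]
    by (auto simp: direct_sum_simps direct_sum_incl_def PiE_iff)
next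
  fix u v assume "u \<in> carrier (N t)" "v \<in> carrier (N t)"
  then show "direct_sum_incl S N t (u \<oplus>\<^bsub>N t\<^esub> v)
      = direct_sum_incl S N t u \<oplus>\<^bsub>direct_sum S N\<^esub> direct_sum_incl S N t v"
    using abelian_monoid.zero_closed[OF abelian_group.axioms(1)[OF module.axioms(2)[OF assms]]]
      abelian_monoid.l_zero[OF abelian_group.axioms(1)[OF module.axioms(2)[OF assms]]]
    by (auto simp: direct_sum_simps direct_sum_incl_def fun_eq_iff)
next
  fix c u assume "c \<in> carrier k" "u \<in> carrier (N t)"
  then show "direct_sum_incl S N t (c \<odot>\<^bsub>N t\<^esub> u)
      = c \<odot>\<^bsub>direct_sum S N\<^esub> direct_sum_incl S N t u"
    using module.smult_r_null[OF assms]
    by (auto simp: direct_sum_simps direct_sum_incl_def fun_eq_iff)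
qed

text \<open>
  A finitely supported family is put together from its entries one at a time, so a submodule that
  contains the images of generators of every summand contains the whole direct sum.
\<close>

lemma direct_sum_generates:
  assumes k: "cring k" and N: "\<And>s. s \<in> S \<Longrightarrow> module k (N s)"
    and G: "\<And>s. s \<in> S \<Longrightarrow> generates k (N s) (G s)"
  shows "generates k (direct_sum S N) (\<Union>s\<in>S. direct_sum_incl S N s ` G s)"
  unfolding generates_def
proof (intro conjI allI impI)
  let ?D = "direct_sum S N"
  interpret D: module k ?D by (rule direct_sum_module[OF k N])
  note incl = direct_sum_incl_linear[of S k N, OF N]
  show "(\<Union>s\<in>S. direct_sum_incl S N s ` G s) \<subseteq> carrier ?D"
    using k_linear_closed[OF incl] G unfolding generates_def by blast
  fix U assume U: "submodule U k ?D" and GU: "(\<Union>s\<in>S. direct_sum_incl S N s ` G s) \<subseteq> U"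
  note UE = D.submoduleE[OF U]
  have inU: "direct_sum_incl S N s y \<in> U" if s: "s \<in> S" and y: "y \<in> carrier (N s)" for s y
    using generates_induct[OF G[OF s] submodule_vimage[OF incl N[OF s] D.module_axioms U] _ y]
      GU G[OF s] s unfolding generates_def by auto
  show "carrier ?D \<subseteq> U"
  proof
    fix u assume u: "u \<in> carrier ?D"
    have "(\<lambda>s\<in>S. if s \<in> T then u s else \<zero>\<^bsub>N s\<^esub>) \<in> U" if "finite T" "T \<subseteq> S" for T
      using that
    proof (induction T rule: finite_induct)
      case empty
      have "\<zero>\<^bsub>?D\<^esub> \<in> U" by (rule submodule_zero[OF D.module_axioms U])
      then show ?case by (simp only: direct_sum_simps(2) empty_iff if_False)
    next
      case (insert t T)
      let ?v = "\<lambda>s\<in>S. if s \<in> T then u s else \<zero>\<^bsub>N s\<^esub>"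
      have z: "\<zero>\<^bsub>N s\<^esub> \<oplus>\<^bsub>N s\<^esub> \<zero>\<^bsub>N s\<^esub> = \<zero>\<^bsub>N s\<^esub>" "u s \<oplus>\<^bsub>N s\<^esub> \<zero>\<^bsub>N s\<^esub> = u s"
          "\<zero>\<^bsub>N s\<^esub> \<oplus>\<^bsub>N s\<^esub> u s = u s" if "s \<in> S" for s
      proof -
        interpret Ns: module k "N s" using N[OF that] .
        have "u s \<in> carrier (N s)" using u that by (auto simp: direct_sum_simps)
        then show "\<zero>\<^bsub>N s\<^esub> \<oplus>\<^bsub>N s\<^esub> \<zero>\<^bsub>N s\<^esub> = \<zero>\<^bsub>N s\<^esub>" "u s \<oplus>\<^bsub>N s\<^esub> \<zero>\<^bsub>N s\<^esub> = u s"
          "\<zero>\<^bsub>N s\<^esub> \<oplus>\<^bsub>N s\<^esub> u s = u s" by auto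
      qed
      have "?v \<in> U" using insert by blast
      moreover have "direct_sum_incl S N t (u t) \<in> U"
        using insert u by (intro inU) (auto simp: direct_sum_simps)
      ultimately have "direct_sum_incl S N t (u t) \<oplus>\<^bsub>?D\<^esub> ?v \<in> U"
        by (intro UE(5))
      moreover have "direct_sum_incl S N t (u t) \<oplus>\<^bsub>?D\<^esub> ?v
          = (\<lambda>s\<in>S. if s \<in> insert t T then u s else \<zero>\<^bsub>N s\<^esub>)"
        using insert(2) z by (auto simp: direct_sum_simps direct_sum_incl_def fun_eq_iff)
      ultimately show ?case by (simp only:)
    qed
    from this[of "{s \<in> S. u s \<noteq> \<zero>\<^bsub>N s\<^esub>}"]
    have "(\<lambda>s\<in>S. if s \<in> {s \<in> S. u s \<noteq> \<zero>\<^bsub>N s\<^esub>} then u s else \<zero>\<^bsub>N s\<^esub>) \<in> U"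
      using u by (auto simp: direct_sum_simps)
    moreover have "(\<lambda>s\<in>S. if s \<in> {s \<in> S. u s \<noteq> \<zero>\<^bsub>N s\<^esub>} then u s else \<zero>\<^bsub>N s\<^esub>) = u"
      using u by (auto simp: direct_sum_simps fun_eq_iff PiE_iff extensional_def)
    ultimately show "u \<in> U" by simp
  qed
qed

text \<open>
  The universal property of the direct sum: a family is sent to the sum of the images of its
  entries, which is finite because each \<open>H s\<close> vanishes at zero.
\<close>

lemma direct_sum_lift:
  assumes k: "cring k" and N: "\<And>s. s \<in> S \<Longrightarrow> module k (N s)" and P: "module k P"
    and H: "\<And>s. s \<in> S \<Longrightarrow> k_linear k (N s) P (H s)"
  shows "\<exists>F. k_linear k (direct_sum S N) P F \<and>
    (\<forall>s\<in>S. \<forall>u\<in>carrier (N s). F (direct_sum_incl S N s u) = H s u)"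
proof (intro exI conjI ballI)
  let ?D = "direct_sum S N"
  interpret P: module k P by fact
  define supp where "supp u = {s \<in> S. u s \<noteq> \<zero>\<^bsub>N s\<^esub>}" for u
  define F where "F u = (\<Oplus>\<^bsub>P\<^esub>s\<in>supp u. H s (u s))" for u
  have mem: "u s \<in> carrier (N s)" if "u \<in> carrier ?D" "s \<in> S" for u s
    using that by (auto simp: direct_sum_simps)
  have Hc: "H s (u s) \<in> carrier P" if "u \<in> carrier ?D" "s \<in> S" for u s
    using k_linear_closed[OF H mem] that by auto
  have fin: "finite (supp u)" if "u \<in> carrier ?D" for u
    using that by (auto simp: direct_sum_simps supp_def)
  \<comment> \<open>The sum may be taken over any finite set containing the support; two families are compared
    over the union of their supports.\<close>
  have F_eq: "F u = (\<Oplus>\<^bsub>P\<^esub>s\<in>T. H s (u s))"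
    if u: "u \<in> carrier ?D" and T: "finite T" "supp u \<subseteq> T" "T \<subseteq> S" for u T
    unfolding F_def
  proof (rule P.add.finprod_mono_neutral_cong_left)
    fix s assume "s \<in> T - supp u"
    then have "s \<in> S" "u s = \<zero>\<^bsub>N s\<^esub>" using T by (auto simp: supp_def)
    then show "H s (u s) = \<zero>\<^bsub>P\<^esub>" using k_linear_zero[OF H N P] by simp
  qed (use T u Hc in auto)
  have D: "module k ?D" by (rule direct_sum_module[OF k N])
  interpret D: module k ?D by fact
  show "k_linear k ?D P F"
  proof (rule k_linearI)
    fix u assume u: "u \<in> carrier ?D"
    then show "F u \<in> carrier P" unfolding F_def
      by (intro P.finsum_closed) (auto simp: supp_def intro: Hc)
  next
    fix u v assume u: "u \<in> carrier ?D" and v: "v \<in> carrier ?D"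
    let ?T = "supp u \<union> supp v \<union> supp (u \<oplus>\<^bsub>?D\<^esub> v)"
    have uv: "u \<oplus>\<^bsub>?D\<^esub> v \<in> carrier ?D" using u v by simp
    have T: "finite ?T" "?T \<subseteq> S" using fin u v uv by (auto simp: supp_def)
    have "F (u \<oplus>\<^bsub>?D\<^esub> v) = (\<Oplus>\<^bsub>P\<^esub>s\<in>?T. H s (u s) \<oplus>\<^bsub>P\<^esub> H s (v s))"
      unfolding F_eq[OF uv T(1) _ T(2), simplified]
      using T(2) u v
      by (intro P.finsum_cong' Pi_I P.a_closed Hc)
         (auto simp: direct_sum_simps(3) k_linear_add[OF H] mem)
    also have "\<dots> = (\<Oplus>\<^bsub>P\<^esub>s\<in>?T. H s (u s)) \<oplus>\<^bsub>P\<^esub> (\<Oplus>\<^bsub>P\<^esub>s\<in>?T. H s (v s))"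
      using T(2) u v by (intro P.finsum_addf Pi_I Hc) auto
    also have "\<dots> = F u \<oplus>\<^bsub>P\<^esub> F v"
    proof -
      have sup: "supp u \<subseteq> ?T" "supp v \<subseteq> ?T" by auto
      show ?thesis unfolding F_eq[OF u T(1) sup(1) T(2)] F_eq[OF v T(1) sup(2) T(2)] ..
    qed
    finally show "F (u \<oplus>\<^bsub>?D\<^esub> v) = F u \<oplus>\<^bsub>P\<^esub> F v" .
  next
    fix c u assume c: "c \<in> carrier k" and u: "u \<in> carrier ?D"
    let ?T = "supp u \<union> supp (c \<odot>\<^bsub>?D\<^esub> u)"
    have cu: "c \<odot>\<^bsub>?D\<^esub> u \<in> carrier ?D" using u c by simp
    have T: "finite ?T" "?T \<subseteq> S" using fin u cu by (auto simp: supp_def)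
    have "F (c \<odot>\<^bsub>?D\<^esub> u) = (\<Oplus>\<^bsub>P\<^esub>s\<in>?T. c \<odot>\<^bsub>P\<^esub> H s (u s))"
      unfolding F_eq[OF cu T(1) _ T(2), simplified]
      using T(2) u c
      by (intro P.finsum_cong' Pi_I P.smult_closed Hc)
         (auto simp: direct_sum_simps(4) k_linear_smult[OF H] mem)
    also have "\<dots> = c \<odot>\<^bsub>P\<^esub> (\<Oplus>\<^bsub>P\<^esub>s\<in>?T. H s (u s))"
      using T u c by (intro P.finsum_smult_ldistr[symmetric] Pi_I Hc) auto
    also have "\<dots> = c \<odot>\<^bsub>P\<^esub> F u"
      using F_eq[OF u T(1) _ T(2)] by auto
    finally show "F (c \<odot>\<^bsub>?D\<^esub> u) = c \<odot>\<^bsub>P\<^esub> F u" .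
  qed
  show "F (direct_sum_incl S N s u) = H s u" if s: "s \<in> S" and u: "u \<in> carrier (N s)" for s u
  proof -
    have i: "direct_sum_incl S N s u \<in> carrier ?D"
      using k_linear_closed[OF direct_sum_incl_linear[of S k N, OF N] u] .
    have sup: "supp (direct_sum_incl S N s u) \<subseteq> {s}" by (auto simp: supp_def direct_sum_incl_def)
    have "F (direct_sum_incl S N s u) = (\<Oplus>\<^bsub>P\<^esub>t\<in>{s}. H t (direct_sum_incl S N s u t))"
      using F_eq[OF i _ sup] s by simp
    also have "\<dots> = H s u"
      using Hc[OF i s] s by (simp add: direct_sum_incl_def P.finsum_insert)
    finally show ?thesis .
  qed
qed

lemma regular_module_simps:
  "carrier (regular_module k) = carrier k" "\<zero>\<^bsub>regular_module k\<^esub> = \<zero>\<^bsub>k\<^esub>"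
  "c \<oplus>\<^bsub>regular_module k\<^esub> d = c \<oplus>\<^bsub>k\<^esub> d" "c \<odot>\<^bsub>regular_module k\<^esub> d = c \<otimes>\<^bsub>k\<^esub> d"
  by (simp_all add: regular_module_def)

lemma regular_module_module:
  assumes "cring k" shows "module k (regular_module k)"
proof -
  interpret cring k by fact
  show ?thesis
    by (rule moduleI, rule assms, rule abelian_groupI)
       (auto simp: regular_module_simps a_ac m_ac l_distr r_distr intro: l_neg)
qed

lemma regular_module_generates:
  assumes "cring k" shows "generates k (regular_module k) {\<one>\<^bsub>k\<^esub>}"
  unfolding generates_def
proof (intro conjI allI impI subsetI)
  interpret cring k by fact
  interpret R: module k "regular_module k" by (rule regular_module_module[OF assms])
  show "c \<in> carrier (regular_module k)" if "c \<in> {\<one>\<^bsub>k\<^esub>}" for c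
    using that by (simp add: regular_module_simps)
  fix U c assume "submodule U k (regular_module k)" "{\<one>\<^bsub>k\<^esub>} \<subseteq> U" "c \<in> carrier (regular_module k)"
  then show "c \<in> U" using R.submoduleE(4)[of U c "\<one>\<^bsub>k\<^esub>"] by (simp add: regular_module_simps)
qed

lemma free_module_module: "cring k \<Longrightarrow> module k (free_module k S)"
  unfolding free_module_def by (intro direct_sum_module regular_module_module)

lemma free_module_generates:
  assumes "cring k" shows "generates k (free_module k S) (free_basis k S ` S)"
proof -
  have "(\<Union>s\<in>S. direct_sum_incl S (\<lambda>_. regular_module k) s ` {\<one>\<^bsub>k\<^esub>}) = free_basis k S ` S"
    by (auto simp: free_basis_def)
  then show ?thesis
    using direct_sum_generates[of k S "\<lambda>_. regular_module k" "\<lambda>_. {\<one>\<^bsub>k\<^esub>}", OF assms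
        regular_module_module[OF assms] regular_module_generates[OF assms]]
    by (simp add: free_module_def)
qed

lemma free_basis_closed: "\<lbrakk>cring k; s \<in> S\<rbrakk> \<Longrightarrow> free_basis k S s \<in> carrier (free_module k S)"
  using free_module_generates[of k S] unfolding generates_def by auto

text \<open>
  A linear map out of \<open>k\<close> is multiplication with the image of \<open>1\<close>; the free module is a direct sum
  of copies of \<open>k\<close>.
\<close>

lemma free_module_lift:
  assumes k: "cring k" and P: "module k P" and g: "\<And>s. s \<in> S \<Longrightarrow> g s \<in> carrier P"
  shows "\<exists>F. k_linear k (free_module k S) P F \<and> (\<forall>s\<in>S. F (free_basis k S s) = g s)"
proof -
  interpret k: cring k by fact
  interpret P: module k P by fact
  have "k_linear k (regular_module k) P (\<lambda>c. c \<odot>\<^bsub>P\<^esub> g s)" if "s \<in> S" for s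
    using g[OF that]
    by (intro k_linearI) (auto simp: regular_module_simps P.smult_l_distr P.smult_assoc1)
  then obtain F where F: "k_linear k (free_module k S) P F"
    "\<forall>s\<in>S. \<forall>c\<in>carrier k. F (direct_sum_incl S (\<lambda>_. regular_module k) s c) = c \<odot>\<^bsub>P\<^esub> g s"
    using direct_sum_lift[of k S "\<lambda>_. regular_module k" P "\<lambda>s c. c \<odot>\<^bsub>P\<^esub> g s",
        OF k regular_module_module[OF k] P]
    unfolding free_module_def regular_module_simps(1) by blast
  show ?thesis
  proof (intro exI conjI ballI)
    show "F (free_basis k S s) = g s" if "s \<in> S" for s
      using F(2) that g[OF that] by (simp add: free_basis_def)
  qed (rule F)
qed

section \<open>Quotients and modules given by generators and relations\<close>

lemma submodule_span_submodule:
  assumes N: "module k N" and R: "R \<subseteq> carrier N"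
  shows "submodule (submodule_span k N R) k N"
proof -
  interpret N: module k N by fact
  note z = submodule_zero[OF N]
  show ?thesis
  proof (rule N.submoduleI)
    show "submodule_span k N R \<subseteq> carrier N"
      unfolding submodule_span_def using N.carrier_is_submodule R by blast
  qed (auto simp: submodule_span_def intro: z N.submoduleE(3-5))
qed

lemma submodule_span_superset: "R \<subseteq> submodule_span k N R"
  unfolding submodule_span_def by blast

lemma submodule_span_minimal: "\<lbrakk>submodule U k N; R \<subseteq> U\<rbrakk> \<Longrightarrow> submodule_span k N R \<subseteq> U"
  unfolding submodule_span_def by blast

text \<open>
  The module axioms are equations, so they pass to a surjective image.  This gives the axioms for
  quotients without computing with cosets.
\<close>

lemma module_surj_image:
  fixes N :: "('k, 'b) module" and Q :: "('k, 'c) module"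
  assumes N: "module k N" and F: "k_linear k N Q F" and surj: "carrier Q = F ` carrier N"
    and zero: "F \<zero>\<^bsub>N\<^esub> = \<zero>\<^bsub>Q\<^esub>"
  shows "module k Q"
proof -
  interpret N: module k N by fact
  note [simp] = k_linear_add[OF F, symmetric] k_linear_smult[OF F, symmetric] zero[symmetric]
  show ?thesis
  proof (rule moduleI)
    show "abelian_group Q"
    proof (rule abelian_groupI)
      fix q assume "q \<in> carrier Q"
      then obtain u where u: "u \<in> carrier N" "q = F u" using surj by auto
      then have "F (\<ominus>\<^bsub>N\<^esub> u) \<oplus>\<^bsub>Q\<^esub> q = \<zero>\<^bsub>Q\<^esub>" by (simp add: N.l_neg)
      then show "\<exists>p\<in>carrier Q. p \<oplus>\<^bsub>Q\<^esub> q = \<zero>\<^bsub>Q\<^esub>" using u surj by blast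
    qed (auto simp: surj N.a_ac)
  qed (auto simp: surj N.smult_l_distr N.smult_r_distr N.smult_assoc1 N.R.is_cring)
qed

text \<open>
  What is needed about cosets: \<open>u \<mapsto> U + u\<close> is a surjective linear map that kills \<open>U\<close>, and its fibres
  are the cosets.  The scalar multiplication is a union over representatives, all of whose members
  coincide because \<open>c \<odot> U \<subseteq> U\<close>.
\<close>

lemma quotient_proj:
  assumes N: "module k N" and U: "submodule U k N"
  shows "module k (quotient_module N U)"
    and "k_linear k N (quotient_module N U) (\<lambda>u. U +>\<^bsub>N\<^esub> u)"
    and "carrier (quotient_module N U) = (\<lambda>u. U +>\<^bsub>N\<^esub> u) ` carrier N"
    and "u \<in> U \<Longrightarrow> U +>\<^bsub>N\<^esub> u = \<zero>\<^bsub>quotient_module N U\<^esub>"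
    and "\<lbrakk>u \<in> carrier N; v \<in> U +>\<^bsub>N\<^esub> u\<rbrakk> \<Longrightarrow> \<exists>w\<in>U. v = w \<oplus>\<^bsub>N\<^esub> u"
    and "u \<in> carrier N \<Longrightarrow> u \<in> U +>\<^bsub>N\<^esub> u"
proof -
  interpret N: module k N by fact
  have sg: "subgroup U (add_monoid N)" using U by (rule submodule.axioms)
  interpret U: abelian_subgroup U N
    by (rule abelian_subgroupI3[OF additive_subgroup.intro[OF sg] N.abelian_group_axioms])
  note UE = N.submoduleE[OF U]
  let ?Q = "quotient_module N U"
  show car: "carrier ?Q = (\<lambda>u. U +>\<^bsub>N\<^esub> u) ` carrier N"
    unfolding quotient_module_def by (auto simp: A_RCOSETS_def')
  show mem: "\<exists>w\<in>U. v = w \<oplus>\<^bsub>N\<^esub> u" if "u \<in> carrier N" "v \<in> U +>\<^bsub>N\<^esub> u" for u v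
    using that by (auto simp: a_r_coset_def')
  show self: "u \<in> U +>\<^bsub>N\<^esub> u" if "u \<in> carrier N" for u by (rule U.a_rcos_self[OF that])
  show "U +>\<^bsub>N\<^esub> u = \<zero>\<^bsub>?Q\<^esub>" if "u \<in> U" for u
    using that UE(1) by (simp add: quotient_module_def N.a_coset_join2 sg additive_subgroup.intro subsetD)
  have eq: "U +>\<^bsub>N\<^esub> v = U +>\<^bsub>N\<^esub> u" if "u \<in> carrier N" "v \<in> U +>\<^bsub>N\<^esub> u" for u v
    using N.a_repr_independence[OF that(2,1) sg] by simp
  show lin: "k_linear k N ?Q (\<lambda>u. U +>\<^bsub>N\<^esub> u)"
  proof (rule k_linearI)
    fix c u assume c: "c \<in> carrier k" and u: "u \<in> carrier N"
    have "U +>\<^bsub>N\<^esub> (c \<odot>\<^bsub>N\<^esub> v) = U +>\<^bsub>N\<^esub> (c \<odot>\<^bsub>N\<^esub> u)" if v: "v \<in> U +>\<^bsub>N\<^esub> u" for v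
    proof -
      obtain w where w: "w \<in> U" "v = w \<oplus>\<^bsub>N\<^esub> u" using mem[OF u v] by auto
      have "c \<odot>\<^bsub>N\<^esub> v = c \<odot>\<^bsub>N\<^esub> w \<oplus>\<^bsub>N\<^esub> c \<odot>\<^bsub>N\<^esub> u" using w c u UE(1) by (auto simp: N.smult_r_distr)
      then have "c \<odot>\<^bsub>N\<^esub> v \<in> U +>\<^bsub>N\<^esub> (c \<odot>\<^bsub>N\<^esub> u)" using UE(4)[OF c w(1)] by (auto simp: a_r_coset_def')
      then show ?thesis using eq c u by simp
    qed
    then have "\<forall>v\<in>U +>\<^bsub>N\<^esub> u. U +>\<^bsub>N\<^esub> (c \<odot>\<^bsub>N\<^esub> v) = U +>\<^bsub>N\<^esub> (c \<odot>\<^bsub>N\<^esub> u)"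
      by (rule ballI)
    then have "(\<Union>v\<in>U +>\<^bsub>N\<^esub> u. U +>\<^bsub>N\<^esub> (c \<odot>\<^bsub>N\<^esub> v)) = U +>\<^bsub>N\<^esub> (c \<odot>\<^bsub>N\<^esub> u)"
      by (rule UN_constant_eq[OF self[OF u]])
    then show "U +>\<^bsub>N\<^esub> (c \<odot>\<^bsub>N\<^esub> u) = c \<odot>\<^bsub>?Q\<^esub> (U +>\<^bsub>N\<^esub> u)"
      by (simp only: quotient_module_def module.select_convs)
  next
    show "U +>\<^bsub>N\<^esub> (u \<oplus>\<^bsub>N\<^esub> v) = (U +>\<^bsub>N\<^esub> u) \<oplus>\<^bsub>?Q\<^esub> (U +>\<^bsub>N\<^esub> v)"
      if "u \<in> carrier N" "v \<in> carrier N" for u v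
      using U.a_rcos_sum[OF that] by (simp add: quotient_module_def)
  qed (simp add: car)
  show "module k ?Q"
  proof (rule module_surj_image[OF N lin car])
    show "U +>\<^bsub>N\<^esub> \<zero>\<^bsub>N\<^esub> = \<zero>\<^bsub>?Q\<^esub>"
      using U.zero_closed UE(1) by (simp add: quotient_module_def N.a_coset_join2 sg additive_subgroup.intro)
  qed
qed

text \<open>
  A map killing \<open>U\<close> is constant on each coset; this constant is the induced value.
\<close>

lemma quotient_lift:
  assumes N: "module k N" and U: "submodule U k N" and P: "module k P"
    and F: "k_linear k N P F" and kill: "\<And>u. u \<in> U \<Longrightarrow> F u = \<zero>\<^bsub>P\<^esub>"
  shows "\<exists>G. k_linear k (quotient_module N U) P G \<and> (\<forall>u\<in>carrier N. G (U +>\<^bsub>N\<^esub> u) = F u)"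
proof (intro exI conjI ballI)
  interpret N: module k N by fact
  interpret P: module k P by fact
  note q = quotient_proj[OF N U]
  interpret Q: module k "quotient_module N U" by (rule q)
  define G where "G X = the_elem (F ` X)" for X
  show G: "G (U +>\<^bsub>N\<^esub> u) = F u" if u: "u \<in> carrier N" for u
  proof -
    have "F v = F u" if v: "v \<in> U +>\<^bsub>N\<^esub> u" for v
    proof -
      obtain w where w: "w \<in> U" "v = w \<oplus>\<^bsub>N\<^esub> u" using q(5)[OF u v] by auto
      then have "w \<in> carrier N" using N.submoduleE(1)[OF U] by auto
      then show ?thesis using w kill[OF w(1)] u by (simp add: k_linear_add[OF F] k_linear_closed[OF F])
    qed
    then show ?thesis unfolding G_def using q(6)[OF u] by (intro the_elem_image_unique) blast+
  qed
  show "k_linear k (quotient_module N U) P G"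
  proof (rule k_linearI)
    fix X Y assume "X \<in> carrier (quotient_module N U)" "Y \<in> carrier (quotient_module N U)"
    then obtain u v where uv: "u \<in> carrier N" "X = U +>\<^bsub>N\<^esub> u" "v \<in> carrier N" "Y = U +>\<^bsub>N\<^esub> v"
      unfolding q(3) by blast
    show "G (X \<oplus>\<^bsub>quotient_module N U\<^esub> Y) = G X \<oplus>\<^bsub>P\<^esub> G Y"
      using k_linear_add[OF q(2) uv(1,3)] k_linear_add[OF F uv(1,3)] G[of "u \<oplus>\<^bsub>N\<^esub> v"] uv G[OF uv(1)] G[OF uv(3)]
      by simp
  next
    fix c X assume c: "c \<in> carrier k" and "X \<in> carrier (quotient_module N U)"
    then obtain u where u: "u \<in> carrier N" "X = U +>\<^bsub>N\<^esub> u" unfolding q(3) by blast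
    show "G (c \<odot>\<^bsub>quotient_module N U\<^esub> X) = c \<odot>\<^bsub>P\<^esub> G X"
      using k_linear_smult[OF q(2) c u(1)] k_linear_smult[OF F c u(1)] G[of "c \<odot>\<^bsub>N\<^esub> u"] u c G[OF u(1)]
      by simp
  next
    fix X assume "X \<in> carrier (quotient_module N U)"
    then obtain u where u: "u \<in> carrier N" "X = U +>\<^bsub>N\<^esub> u" unfolding q(3) by blast
    then show "G X \<in> carrier P" using G[OF u(1)] k_linear_closed[OF F u(1)] by simp
  qed
qed

lemma quotient_generates:
  assumes N: "module k N" and U: "submodule U k N" and G: "generates k N G"
  shows "generates k (quotient_module N U) ((\<lambda>u. U +>\<^bsub>N\<^esub> u) ` G)"
  unfolding generates_def
proof (intro conjI allI impI)
  note q = quotient_proj[OF N U]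
  show "(\<lambda>u. U +>\<^bsub>N\<^esub> u) ` G \<subseteq> carrier (quotient_module N U)"
    using G unfolding q(3) generates_def by auto
  fix V assume V: "submodule V k (quotient_module N U)" "(\<lambda>u. U +>\<^bsub>N\<^esub> u) ` G \<subseteq> V"
  have "U +>\<^bsub>N\<^esub> u \<in> V" if "u \<in> carrier N" for u
    using generates_induct[OF G submodule_vimage[OF q(2) N q(1) V(1)] _ that] V(2) G
    unfolding generates_def by auto
  then show "carrier (quotient_module N U) \<subseteq> V" unfolding q(3) by auto
qed

text \<open>Tensor products and tensor powers are both of this form, so they share the lemmas below.\<close>

definition presented :: "'k ring \<Rightarrow> 's set \<Rightarrow> ('s \<Rightarrow> 'k) set \<Rightarrow> ('k, ('s \<Rightarrow> 'k) set) module"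
  where "presented k S R =
    quotient_module (free_module k S) (submodule_span k (free_module k S) R)"

definition presented_gen :: "'k ring \<Rightarrow> 's set \<Rightarrow> ('s \<Rightarrow> 'k) set \<Rightarrow> 's \<Rightarrow> ('s \<Rightarrow> 'k) set"
  where "presented_gen k S R s =
    submodule_span k (free_module k S) R +>\<^bsub>free_module k S\<^esub> free_basis k S s"

lemma presented_module:
  assumes "cring k" "R \<subseteq> carrier (free_module k S)"
  shows "module k (presented k S R)"
  unfolding presented_def
  by (intro quotient_proj(1) submodule_span_submodule free_module_module assms)

lemma presented_generates:
  assumes "cring k" "R \<subseteq> carrier (free_module k S)"
  shows "generates k (presented k S R) (presented_gen k S R ` S)"
  using quotient_generates[OF free_module_module submodule_span_submodule free_module_generates,
      OF assms(1) free_module_module assms(2) assms(1), OF assms(1)]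
  unfolding presented_def presented_gen_def by (simp add: image_image)

text \<open>
  Prescribed values on generators extend exactly when the linear map that they define on the free
  module kills the relations.
\<close>

lemma presented_lift:
  assumes k: "cring k" and R: "R \<subseteq> carrier (free_module k S)" and P: "module k P"
    and g: "\<And>s. s \<in> S \<Longrightarrow> g s \<in> carrier P"
    and kill: "\<And>F r. \<lbrakk>k_linear k (free_module k S) P F; \<And>s. s \<in> S \<Longrightarrow> F (free_basis k S s) = g s;
                 r \<in> R\<rbrakk> \<Longrightarrow> F r = \<zero>\<^bsub>P\<^esub>"
  shows "\<exists>G. k_linear k (presented k S R) P G \<and> (\<forall>s\<in>S. G (presented_gen k S R s) = g s)"
proof -
  note free = free_module_module[OF k, of S]
  obtain F where F: "k_linear k (free_module k S) P F" "\<And>s. s \<in> S \<Longrightarrow> F (free_basis k S s) = g s"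
    using free_module_lift[of k P S g, OF k P g] by blast
  interpret free: module k "free_module k S" by fact
  interpret P: module k P by fact
  have "submodule {\<zero>\<^bsub>P\<^esub>} k P" by (rule P.submoduleI) auto
  then have "submodule {u \<in> carrier (free_module k S). F u \<in> {\<zero>\<^bsub>P\<^esub>}} k (free_module k S)"
    by (rule submodule_vimage[OF F(1) free P])
  then have "submodule_span k (free_module k S) R
      \<subseteq> {u \<in> carrier (free_module k S). F u \<in> {\<zero>\<^bsub>P\<^esub>}}"
    by (rule submodule_span_minimal) (use R kill[OF F] in auto)
  then have "F u = \<zero>\<^bsub>P\<^esub>" if "u \<in> submodule_span k (free_module k S) R" for u
    using that by auto
  then obtain G where "k_linear k (presented k S R) P G"
    "\<forall>u\<in>carrier (free_module k S).
       G (submodule_span k (free_module k S) R +>\<^bsub>free_module k S\<^esub> u) = F u"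
    using quotient_lift[OF free submodule_span_submodule[OF free R] P F(1), folded presented_def]
    by blast
  then show ?thesis
    using F(2) free_basis_closed[OF k] unfolding presented_gen_def by (metis (no_types, lifting))
qed

text \<open>
  The defining relations of tensor products and powers express additivity or homogeneity in one
  place; the next two lemmas turn them into equations between generators.
\<close>

lemma presented_add_relation:
  assumes k: "cring k" and R: "R \<subseteq> carrier (free_module k S)"
    and s: "s \<in> S" "s' \<in> S" "s'' \<in> S"
    and r: "free_basis k S s \<ominus>\<^bsub>free_module k S\<^esub>
      (free_basis k S s' \<oplus>\<^bsub>free_module k S\<^esub> free_basis k S s'') \<in> R"
  shows "presented_gen k S R s = presented_gen k S R s' \<oplus>\<^bsub>presented k S R\<^esub> presented_gen k S R s''"
proof -
  note free = free_module_module[OF k, of S]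
  interpret free: module k "free_module k S" by fact
  note q = quotient_proj[OF free submodule_span_submodule[OF free R], folded presented_def]
  interpret Q: module k "presented k S R" by (rule q)
  note b = s[THEN free_basis_closed[OF k]]
  note cl = b[THEN k_linear_closed[OF q(2)], folded presented_gen_def]
  have "presented_gen k S R s \<ominus>\<^bsub>presented k S R\<^esub>
      (presented_gen k S R s' \<oplus>\<^bsub>presented k S R\<^esub> presented_gen k S R s'') = \<zero>\<^bsub>presented k S R\<^esub>"
    using q(4)[OF subsetD[OF submodule_span_superset r]] b
    by (simp add: k_linear_diff[OF q(2) free q(1)] k_linear_add[OF q(2)] presented_gen_def)
  then show ?thesis using module_diff_zero[OF q(1)] cl by simp
qed

lemma presented_smult_relation:
  assumes k: "cring k" and R: "R \<subseteq> carrier (free_module k S)"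
    and s: "s \<in> S" "s' \<in> S" and c: "c \<in> carrier k"
    and r: "free_basis k S s \<ominus>\<^bsub>free_module k S\<^esub> c \<odot>\<^bsub>free_module k S\<^esub> free_basis k S s' \<in> R"
  shows "presented_gen k S R s = c \<odot>\<^bsub>presented k S R\<^esub> presented_gen k S R s'"
proof -
  note free = free_module_module[OF k, of S]
  interpret free: module k "free_module k S" by fact
  note q = quotient_proj[OF free submodule_span_submodule[OF free R], folded presented_def]
  interpret Q: module k "presented k S R" by (rule q)
  note b = s[THEN free_basis_closed[OF k]]
  note cl = b[THEN k_linear_closed[OF q(2)], folded presented_gen_def]
  have "presented_gen k S R s \<ominus>\<^bsub>presented k S R\<^esub> c \<odot>\<^bsub>presented k S R\<^esub> presented_gen k S R s'
      = \<zero>\<^bsub>presented k S R\<^esub>"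
    using q(4)[OF subsetD[OF submodule_span_superset r]] b c
    by (simp add: k_linear_diff[OF q(2) free q(1)] k_linear_smult[OF q(2)] presented_gen_def)
  then show ?thesis using module_diff_zero[OF q(1)] cl c by simp
qed

section \<open>Tensor products and tensor powers\<close>

lemma tensor_product_presented:
  "tensor_product k N N' = presented k (carrier N \<times> carrier N') (tensor_relations k N N')"
  "pure_tensor k N N' u w
    = presented_gen k (carrier N \<times> carrier N') (tensor_relations k N N') (u, w)"
  by (simp_all add: tensor_product_def presented_def pure_tensor_def presented_gen_def Let_def)

lemma tensor_relations_carrier:
  assumes "module k N" "module k N'"
  shows "tensor_relations k N N' \<subseteq> carrier (free_module k (carrier N \<times> carrier N'))"
proof -
  interpret N: module k N by fact
  interpret N': module k N' by fact
  interpret free: module k "free_module k (carrier N \<times> carrier N')"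
    by (rule free_module_module[OF N.R.is_cring])
  have "free_basis k (carrier N \<times> carrier N') (u, w) \<in> carrier (free_module k (carrier N \<times> carrier N'))"
    if "u \<in> carrier N" "w \<in> carrier N'" for u w
    using that by (intro free_basis_closed N.R.is_cring) auto
  then show ?thesis unfolding tensor_relations_def Let_def by auto
qed

lemma tensor_relationsI:
  fixes k N N'
  defines "S \<equiv> carrier N \<times> carrier N'"
  shows "\<lbrakk>u \<in> carrier N; v \<in> carrier N; w \<in> carrier N'\<rbrakk> \<Longrightarrow>
      free_basis k S (u \<oplus>\<^bsub>N\<^esub> v, w) \<ominus>\<^bsub>free_module k S\<^esub>
        (free_basis k S (u, w) \<oplus>\<^bsub>free_module k S\<^esub> free_basis k S (v, w)) \<in> tensor_relations k N N'"
    and "\<lbrakk>u \<in> carrier N; v' \<in> carrier N'; w \<in> carrier N'\<rbrakk> \<Longrightarrow>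
      free_basis k S (u, v' \<oplus>\<^bsub>N'\<^esub> w) \<ominus>\<^bsub>free_module k S\<^esub>
        (free_basis k S (u, v') \<oplus>\<^bsub>free_module k S\<^esub> free_basis k S (u, w)) \<in> tensor_relations k N N'"
    and "\<lbrakk>c \<in> carrier k; u \<in> carrier N; w \<in> carrier N'\<rbrakk> \<Longrightarrow>
      free_basis k S (c \<odot>\<^bsub>N\<^esub> u, w) \<ominus>\<^bsub>free_module k S\<^esub>
        c \<odot>\<^bsub>free_module k S\<^esub> free_basis k S (u, w) \<in> tensor_relations k N N'"
    and "\<lbrakk>c \<in> carrier k; u \<in> carrier N; w \<in> carrier N'\<rbrakk> \<Longrightarrow>
      free_basis k S (u, c \<odot>\<^bsub>N'\<^esub> w) \<ominus>\<^bsub>free_module k S\<^esub>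
        c \<odot>\<^bsub>free_module k S\<^esub> free_basis k S (u, w) \<in> tensor_relations k N N'"
  unfolding tensor_relations_def Let_def S_def by blast+

lemma tensor_product_module:
  assumes "module k N" "module k N'"
  shows "module k (tensor_product k N N')"
  unfolding tensor_product_presented
  using assms(1) by (intro presented_module tensor_relations_carrier assms module.axioms(1))

lemma pure_tensor_closed:
  assumes "module k N" "module k N'" "u \<in> carrier N" "w \<in> carrier N'"
  shows "pure_tensor k N N' u w \<in> carrier (tensor_product k N N')"
  using presented_generates[OF module.axioms(1) tensor_relations_carrier, OF assms(1,1,2)] assms(3,4)
  unfolding tensor_product_presented generates_def by blast

lemma pure_tensor_linear_left:
  assumes N: "module k N" and N': "module k N'" and w: "w \<in> carrier N'"
  shows "k_linear k N (tensor_product k N N') (\<lambda>u. pure_tensor k N N' u w)"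
proof (rule k_linearI)
  interpret N: module k N by fact
  interpret N': module k N' by fact
  note R = tensor_relations_carrier[OF N N']
  show "pure_tensor k N N' u w \<in> carrier (tensor_product k N N')" if "u \<in> carrier N" for u
    by (rule pure_tensor_closed[OF N N' that w])
  show "pure_tensor k N N' (u \<oplus>\<^bsub>N\<^esub> v) w
      = pure_tensor k N N' u w \<oplus>\<^bsub>tensor_product k N N'\<^esub> pure_tensor k N N' v w"
    if "u \<in> carrier N" "v \<in> carrier N" for u v
    unfolding tensor_product_presented
    by (rule presented_add_relation[OF N.R.is_cring R])
       (use that w in \<open>auto intro: tensor_relationsI\<close>)
  show "pure_tensor k N N' (c \<odot>\<^bsub>N\<^esub> u) w = c \<odot>\<^bsub>tensor_product k N N'\<^esub> pure_tensor k N N' u w"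
    if "c \<in> carrier k" "u \<in> carrier N" for c u
    unfolding tensor_product_presented
    by (rule presented_smult_relation[OF N.R.is_cring R])
       (use that w in \<open>auto intro: tensor_relationsI\<close>)
qed

lemma pure_tensor_linear_right:
  assumes N: "module k N" and N': "module k N'" and u: "u \<in> carrier N"
  shows "k_linear k N' (tensor_product k N N') (pure_tensor k N N' u)"
proof (rule k_linearI)
  interpret N: module k N by fact
  interpret N': module k N' by fact
  note R = tensor_relations_carrier[OF N N']
  show "pure_tensor k N N' u w \<in> carrier (tensor_product k N N')" if "w \<in> carrier N'" for w
    by (rule pure_tensor_closed[OF N N' u that])
  show "pure_tensor k N N' u (v \<oplus>\<^bsub>N'\<^esub> w)
      = pure_tensor k N N' u v \<oplus>\<^bsub>tensor_product k N N'\<^esub> pure_tensor k N N' u w"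
    if "v \<in> carrier N'" "w \<in> carrier N'" for v w
    unfolding tensor_product_presented
    by (rule presented_add_relation[OF N.R.is_cring R])
       (use that u in \<open>auto intro: tensor_relationsI\<close>)
  show "pure_tensor k N N' u (c \<odot>\<^bsub>N'\<^esub> w) = c \<odot>\<^bsub>tensor_product k N N'\<^esub> pure_tensor k N N' u w"
    if "c \<in> carrier k" "w \<in> carrier N'" for c w
    unfolding tensor_product_presented
    by (rule presented_smult_relation[OF N.R.is_cring R])
       (use that u in \<open>auto intro: tensor_relationsI\<close>)
qed

lemma tensor_generates:
  assumes N: "module k N" and N': "module k N'"
    and G: "generates k N G" and G': "generates k N' G'"
  shows "generates k (tensor_product k N N') ((\<lambda>(u, w). pure_tensor k N N' u w) ` (G \<times> G'))"
  unfolding generates_def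
proof (intro conjI allI impI)
  let ?T = "tensor_product k N N'"
  note T = tensor_product_module[OF N N']
  have G'_sub: "G' \<subseteq> carrier N'" and G_sub: "G \<subseteq> carrier N" using G G' by (auto simp: generates_def)
  then show "(\<lambda>(u, w). pure_tensor k N N' u w) ` (G \<times> G') \<subseteq> carrier ?T"
    by (auto intro!: pure_tensor_closed[OF N N'])
  fix U assume U: "submodule U k ?T" and GU: "(\<lambda>(u, w). pure_tensor k N N' u w) ` (G \<times> G') \<subseteq> U"
  have left: "pure_tensor k N N' u w \<in> U" if "u \<in> carrier N" "w \<in> G'" for u w
  proof -
    have w: "w \<in> carrier N'" using that(2) G'_sub by auto
    have "g \<in> {u \<in> carrier N. pure_tensor k N N' u w \<in> U}" if "g \<in> G" for g
      using that \<open>w \<in> G'\<close> GU G_sub by auto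
    from generates_induct[OF G submodule_vimage[OF pure_tensor_linear_left[OF N N' w] N T U] this that(1)]
    show ?thesis by simp
  qed
  have "pure_tensor k N N' u w \<in> U" if "u \<in> carrier N" "w \<in> carrier N'" for u w
  proof -
    have "g \<in> {w \<in> carrier N'. pure_tensor k N N' u w \<in> U}" if "g \<in> G'" for g
      using that \<open>u \<in> carrier N\<close> left G'_sub by auto
    from generates_induct[OF G' submodule_vimage[OF pure_tensor_linear_right[OF N N' that(1)] N' T U]
        this that(2)]
    show ?thesis by simp
  qed
  moreover have "generates k ?T (presented_gen k (carrier N \<times> carrier N') (tensor_relations k N N')
      ` (carrier N \<times> carrier N'))"
    using presented_generates[OF module.axioms(1) tensor_relations_carrier, OF N N N']
    by (simp add: tensor_product_presented)
  ultimately show "carrier ?T \<subseteq> U"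
    using U unfolding generates_def tensor_product_presented(2) by blast
qed

lemma tensor_lift:
  assumes N: "module k N" and N': "module k N'" and P: "module k P"
    and left: "\<And>w. w \<in> carrier N' \<Longrightarrow> k_linear k N P (\<lambda>u. \<phi> u w)"
    and right: "\<And>u. u \<in> carrier N \<Longrightarrow> k_linear k N' P (\<phi> u)"
  shows "\<exists>F. k_linear k (tensor_product k N N') P F \<and>
    (\<forall>u\<in>carrier N. \<forall>w\<in>carrier N'. F (pure_tensor k N N' u w) = \<phi> u w)"
proof -
  interpret N: module k N by fact
  interpret N': module k N' by fact
  interpret P: module k P by fact
  let ?S = "carrier N \<times> carrier N'" and ?R = "tensor_relations k N N'"
  have closed: "\<phi> u w \<in> carrier P" if "u \<in> carrier N" "w \<in> carrier N'" for u w
    using k_linear_closed[OF left that(1)] that by auto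
  have "\<exists>F. k_linear k (presented k ?S ?R) P F \<and> (\<forall>s\<in>?S. F (presented_gen k ?S ?R s) = case_prod \<phi> s)"
  proof (rule presented_lift[OF N.R.is_cring tensor_relations_carrier[OF N N'] P])
    show "case_prod \<phi> s \<in> carrier P" if "s \<in> ?S" for s using closed that by auto
    fix F r assume F: "k_linear k (free_module k ?S) P F"
      and Fg: "\<And>s. s \<in> ?S \<Longrightarrow> F (free_basis k ?S s) = case_prod \<phi> s" and r: "r \<in> ?R"
    note free = free_module_module[OF N.R.is_cring, of ?S]
    interpret free: module k "free_module k ?S" by fact
    have e: "free_basis k ?S (u, w) \<in> carrier (free_module k ?S)"
      if "u \<in> carrier N" "w \<in> carrier N'" for u w
      using that by (intro free_basis_closed N.R.is_cring) auto
    have Fe: "F (free_basis k ?S (u, w)) = \<phi> u w" if "u \<in> carrier N" "w \<in> carrier N'" for u w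
      using Fg that by auto
    have diff_self: "y \<ominus>\<^bsub>P\<^esub> y = \<zero>\<^bsub>P\<^esub>" if "y \<in> carrier P" for y
      using that by (simp add: a_minus_def P.r_neg)
    show "F r = \<zero>\<^bsub>P\<^esub>"
      using r unfolding tensor_relations_def Let_def
      by (auto simp: k_linear_diff[OF F free P] k_linear_add[OF F] k_linear_smult[OF F] e Fe
          k_linear_add[OF left] k_linear_add[OF right] k_linear_smult[OF left]
          k_linear_smult[OF right] closed diff_self)
  qed
  then show ?thesis by (auto simp: tensor_product_presented)
qed

text \<open>
  Linearity in the first variable need only be known on generators of \<open>N\<close>: the extensions
  depend linearly on \<open>w\<close>, because they are determined by their values on these generators.
\<close>

lemma tensor_lift_generators:
  assumes N: "module k N" and N': "module k N'" and P: "module k P"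
    and G: "generates k N (\<gamma> ` J)"
    and left: "\<And>w. w \<in> carrier N' \<Longrightarrow> \<exists>H. k_linear k N P H \<and> (\<forall>j\<in>J. H (\<gamma> j) = \<psi> j w)"
    and right: "\<And>j. j \<in> J \<Longrightarrow> k_linear k N' P (\<psi> j)"
  shows "\<exists>F. k_linear k (tensor_product k N N') P F \<and>
    (\<forall>j\<in>J. \<forall>w\<in>carrier N'. F (pure_tensor k N N' (\<gamma> j) w) = \<psi> j w)"
proof -
  interpret N': module k N' by fact
  obtain H where H: "\<And>w. w \<in> carrier N' \<Longrightarrow> k_linear k N P (H w)"
    and H\<gamma>: "\<And>w j. \<lbrakk>w \<in> carrier N'; j \<in> J\<rbrakk> \<Longrightarrow> H w (\<gamma> j) = \<psi> j w"
    using left by metis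
  have \<gamma>: "\<gamma> j \<in> carrier N" if "j \<in> J" for j using G that by (auto simp: generates_def)
  have right_H: "k_linear k N' P (\<lambda>w. H w u)" if u: "u \<in> carrier N" for u
  proof (rule k_linearI)
    show "H w u \<in> carrier P" if "w \<in> carrier N'" for w using k_linear_closed[OF H[OF that] u] .
    show "H (v \<oplus>\<^bsub>N'\<^esub> w) u = H v u \<oplus>\<^bsub>P\<^esub> H w u" if v: "v \<in> carrier N'" and w: "w \<in> carrier N'" for v w
    proof (rule k_linear_eqI[OF H k_linear_plus[OF H[OF v] H[OF w] P] N P G _ u])
      show "H (v \<oplus>\<^bsub>N'\<^esub> w) g = H v g \<oplus>\<^bsub>P\<^esub> H w g" if "g \<in> \<gamma> ` J" for g
        using that v w H\<gamma> k_linear_add[OF right] by auto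
    qed (use v w in simp)
    show "H (c \<odot>\<^bsub>N'\<^esub> w) u = c \<odot>\<^bsub>P\<^esub> H w u" if c: "c \<in> carrier k" and w: "w \<in> carrier N'" for c w
    proof (rule k_linear_eqI[OF H k_linear_scale[OF H[OF w] c P] N P G _ u])
      show "H (c \<odot>\<^bsub>N'\<^esub> w) g = c \<odot>\<^bsub>P\<^esub> H w g" if "g \<in> \<gamma> ` J" for g
        using that c w H\<gamma> k_linear_smult[OF right] by auto
    qed (use c w in simp)
  qed
  have "\<exists>F. k_linear k (tensor_product k N N') P F \<and>
    (\<forall>u\<in>carrier N. \<forall>w\<in>carrier N'. F (pure_tensor k N N' u w) = H w u)"
    by (rule tensor_lift[OF N N' P H right_H])
  then show ?thesis using \<gamma> H\<gamma> by metis
qed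

text \<open>
  Linearity in the \<open>i\<close>-th entry is linearity of \<open>a \<mapsto> \<phi> (as[i := a])\<close>, the form in which the
  relations of \<^const>\<open>tensor_power\<close> are written.
\<close>

definition multilinear ::
    "'k ring \<Rightarrow> ('k, 'a) module \<Rightarrow> nat \<Rightarrow> ('k, 'c) module \<Rightarrow> ('a list \<Rightarrow> 'c) \<Rightarrow> bool"
  where "multilinear k B x P \<phi> \<longleftrightarrow>
    (\<forall>as\<in>tuples B x. \<phi> as \<in> carrier P) \<and>
    (\<forall>as\<in>tuples B x. \<forall>i<x. k_linear k B P (\<lambda>a. \<phi> (as[i := a])))"

lemma tuples_update: "\<lbrakk>as \<in> tuples B x; a \<in> carrier B\<rbrakk> \<Longrightarrow> as[i := a] \<in> tuples B x"
  unfolding tuples_def using set_update_subset_insert[of as i a] by auto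

lemma tensor_power_presented:
  "tensor_power k B x = presented k (tuples B x) (power_relations k B x)"
  "power_tensor k B as
    = presented_gen k (tuples B (length as)) (power_relations k B (length as)) as"
  by (simp_all add: tensor_power_def presented_def power_tensor_def presented_gen_def Let_def)

lemma power_tensor_presented:
  "as \<in> tuples B x \<Longrightarrow> power_tensor k B as = presented_gen k (tuples B x) (power_relations k B x) as"
  by (auto simp: tensor_power_presented tuples_def)

lemma power_relations_carrier:
  assumes "module k B"
  shows "power_relations k B x \<subseteq> carrier (free_module k (tuples B x))"
proof -
  interpret B: module k B by fact
  interpret free: module k "free_module k (tuples B x)" by (rule free_module_module[OF B.R.is_cring])
  have "free_basis k (tuples B x) (as[i := a]) \<in> carrier (free_module k (tuples B x))"
    if "as \<in> tuples B x" "a \<in> carrier B" for as i a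
    using that by (intro free_basis_closed B.R.is_cring tuples_update)
  then show ?thesis unfolding power_relations_def Let_def by auto
qed

lemma tensor_power_module:
  assumes "module k B" shows "module k (tensor_power k B x)"
  unfolding tensor_power_presented
  using assms by (intro presented_module power_relations_carrier module.axioms(1))

lemma tuples_power_generates:
  assumes "module k B"
  shows "generates k (tensor_power k B x) (power_tensor k B ` tuples B x)"
  using presented_generates[OF module.axioms(1) power_relations_carrier, OF assms assms, of x]
  unfolding tensor_power_presented(1)
  by (simp add: power_tensor_presented cong: image_cong)

lemma power_tensor_multilinear:
  assumes B: "module k B"
  shows "multilinear k B x (tensor_power k B x) (power_tensor k B)"
  unfolding multilinear_def
proof (intro conjI ballI allI impI)
  interpret B: module k B by fact
  note R = power_relations_carrier[OF B, of x]
  show cl: "power_tensor k B as \<in> carrier (tensor_power k B x)" if "as \<in> tuples B x" for as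
    using tuples_power_generates[OF B, of x] that unfolding generates_def by auto
  fix as i assume as: "as \<in> tuples B x" and i: "i < x"
  note up = tuples_update[OF as]
  show "k_linear k B (tensor_power k B x) (\<lambda>a. power_tensor k B (as[i := a]))"
  proof (rule k_linearI)
    show "power_tensor k B (as[i := a]) \<in> carrier (tensor_power k B x)" if "a \<in> carrier B" for a
      by (rule cl[OF up[OF that]])
    show "power_tensor k B (as[i := a \<oplus>\<^bsub>B\<^esub> b])
        = power_tensor k B (as[i := a]) \<oplus>\<^bsub>tensor_power k B x\<^esub> power_tensor k B (as[i := b])"
      if "a \<in> carrier B" "b \<in> carrier B" for a b
      unfolding tensor_power_presented(1)
        power_tensor_presented[OF up[OF that(1)]] power_tensor_presented[OF up[OF that(2)]]
        power_tensor_presented[OF up[OF B.M.a_closed[OF that]]]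
      by (rule presented_add_relation[OF B.R.is_cring R])
         (use that up as i in \<open>auto simp: power_relations_def Let_def\<close>)
    show "power_tensor k B (as[i := c \<odot>\<^bsub>B\<^esub> a])
        = c \<odot>\<^bsub>tensor_power k B x\<^esub> power_tensor k B (as[i := a])"
      if "c \<in> carrier k" "a \<in> carrier B" for c a
      unfolding tensor_power_presented(1)
        power_tensor_presented[OF up[OF that(2)]] power_tensor_presented[OF up[OF B.smult_closed[OF that]]]
      by (rule presented_smult_relation[OF B.R.is_cring R])
         (use that up as i in \<open>auto simp: power_relations_def Let_def\<close>)
  qed
qed

text \<open>
  Entries are replaced one after the other: once the tensors with all entries from the \<open>j\<close>-th on
  in \<open>G\<close> lie in a submodule, linearity in the \<open>j\<close>-th entry frees that entry as well.
\<close>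

lemma tensor_power_generates:
  assumes B: "module k B" and G: "generates k B G"
  shows "generates k (tensor_power k B x) (power_tensor k B ` {as. length as = x \<and> set as \<subseteq> G})"
  unfolding generates_def
proof (intro conjI allI impI)
  let ?T = "tensor_power k B x"
  note T = tensor_power_module[OF B, of x]
  note ml = power_tensor_multilinear[OF B, of x, unfolded multilinear_def]
  have G_sub: "G \<subseteq> carrier B" using G by (auto simp: generates_def)
  show "power_tensor k B ` {as. length as = x \<and> set as \<subseteq> G} \<subseteq> carrier ?T"
    using ml G_sub by (auto simp: tuples_def)
  fix U assume U: "submodule U k ?T" and GU: "power_tensor k B ` {as. length as = x \<and> set as \<subseteq> G} \<subseteq> U"
  have "power_tensor k B as \<in> U"
    if "as \<in> tuples B x" "j \<le> x" "\<And>i. \<lbrakk>j \<le> i; i < x\<rbrakk> \<Longrightarrow> as ! i \<in> G" for as j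
    using that
  proof (induction j arbitrary: as)
    case 0
    then have "set as \<subseteq> G" "length as = x" by (auto simp: tuples_def in_set_conv_nth)
    then show ?case using GU by auto
  next
    case (Suc j)
    have len: "length as = x" using Suc.prems(1) by (simp add: tuples_def)
    have j: "j < x" using Suc.prems(2) by simp
    have lin: "k_linear k B ?T (\<lambda>a. power_tensor k B (as[j := a]))" using ml Suc.prems(1) j by blast
    have aj: "as ! j \<in> carrier B" using Suc.prems(1) j by (auto simp: tuples_def)
    have "as ! j \<in> {a \<in> carrier B. power_tensor k B (as[j := a]) \<in> U}"
    proof (rule generates_induct[OF G submodule_vimage[OF lin B T U] _ aj])
      fix g assume g: "g \<in> G"
      have "power_tensor k B (as[j := g]) \<in> U"
      proof (rule Suc.IH)
        show "as[j := g] \<in> tuples B x" using tuples_update[OF Suc.prems(1)] g G_sub by auto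
        show "as[j := g] ! i \<in> G" if "j \<le> i" "i < x" for i
          using Suc.prems(3)[of i] g that len by (cases "i = j") auto
      qed (use j in simp)
      then show "g \<in> {a \<in> carrier B. power_tensor k B (as[j := a]) \<in> U}" using g G_sub by auto
    qed
    then show ?case by simp
  qed
  from this[of _ x] have "power_tensor k B as \<in> U" if "as \<in> tuples B x" for as using that by simp
  then show "carrier ?T \<subseteq> U"
    using tuples_power_generates[OF B, of x] U unfolding generates_def by blast
qed

lemma tensor_power_lift:
  assumes B: "module k B" and P: "module k P" and ml: "multilinear k B x P \<phi>"
  shows "\<exists>F. k_linear k (tensor_power k B x) P F \<and> (\<forall>as\<in>tuples B x. F (power_tensor k B as) = \<phi> as)"
proof -
  interpret B: module k B by fact
  interpret P: module k P by fact
  let ?S = "tuples B x" and ?R = "power_relations k B x"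
  have closed: "\<phi> as \<in> carrier P" if "as \<in> ?S" for as using ml that by (auto simp: multilinear_def)
  have lin: "k_linear k B P (\<lambda>a. \<phi> (as[i := a]))" if "as \<in> ?S" "i < x" for as i
    using ml that by (auto simp: multilinear_def)
  have "\<exists>F. k_linear k (presented k ?S ?R) P F \<and> (\<forall>s\<in>?S. F (presented_gen k ?S ?R s) = \<phi> s)"
  proof (rule presented_lift[OF B.R.is_cring power_relations_carrier[OF B] P closed])
    fix F r assume F: "k_linear k (free_module k ?S) P F"
      and Fg: "\<And>s. s \<in> ?S \<Longrightarrow> F (free_basis k ?S s) = \<phi> s" and r: "r \<in> ?R"
    note free = free_module_module[OF B.R.is_cring, of ?S]
    interpret free: module k "free_module k ?S" by fact
    have e: "free_basis k ?S (as[i := a]) \<in> carrier (free_module k ?S)"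
      and Fe: "F (free_basis k ?S (as[i := a])) = \<phi> (as[i := a])"
      and cl: "\<phi> (as[i := a]) \<in> carrier P"
      if "as \<in> ?S" "a \<in> carrier B" for as i a
      using tuples_update[OF that] by (auto intro!: closed Fg free_basis_closed[OF B.R.is_cring])
    have diff_self: "y \<ominus>\<^bsub>P\<^esub> y = \<zero>\<^bsub>P\<^esub>" if "y \<in> carrier P" for y
      using that by (simp add: a_minus_def P.r_neg)
    show "F r = \<zero>\<^bsub>P\<^esub>"
      using r unfolding power_relations_def Let_def
      by (auto simp: k_linear_diff[OF F free P] k_linear_add[OF F] k_linear_smult[OF F] e Fe cl
          k_linear_add[OF lin] k_linear_smult[OF lin] diff_self)
  qed
  then show ?thesis unfolding tensor_power_presented(1) by (auto simp: power_tensor_presented)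
qed

section \<open>The modules of the Robinson--Whitehouse complex\<close>

text \<open>
  The maps \<open>\<phi>\<close> on tuples and elements of \<open>M\<close> that factor through \<open>B\<^sup>\<otimes>\<^sup>x \<otimes> M\<close>.
\<close>

definition rw_multilinear ::
    "'k ring \<Rightarrow> ('k, 'a) module \<Rightarrow> ('k, 'm) module \<Rightarrow> nat \<Rightarrow> ('k, 'c) module
      \<Rightarrow> ('a list \<Rightarrow> 'm \<Rightarrow> 'c) \<Rightarrow> bool"
  where "rw_multilinear k B M x P \<phi> \<longleftrightarrow>
    (\<forall>m\<in>carrier M. multilinear k B x P (\<lambda>as. \<phi> as m)) \<and>
    (\<forall>as\<in>tuples B x. k_linear k M P (\<phi> as))"

lemma rw_summand_module:
  assumes "module k B" "module k M"
  shows "module k (rw_summand k B M n x)"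
  unfolding rw_summand_def
  using assms by (intro tensor_product_module free_module_module tensor_power_module module.axioms(1))

lemma rw_module_module:
  assumes "module k B" "module k M"
  shows "module k (rw_module k B M n)"
  unfolding rw_module_def
  using assms by (intro direct_sum_module rw_summand_module) (auto intro: module.axioms(1))

definition rw_summand_gen ::
    "'k ring \<Rightarrow> ('k, 'a) module \<Rightarrow> ('k, 'm) module \<Rightarrow> nat \<Rightarrow> nat \<Rightarrow> ('a, 'm) rw_index
      \<Rightarrow> ('k, 'a, 'm) rw_summand"
  where "rw_summand_gen k B M n x = (\<lambda>(fs, as, m).
    pure_tensor k (free_module k (nerve_strings n x 1)) (tensor_product k (tensor_power k B x) M)
      (free_basis k (nerve_strings n x 1) fs)
      (pure_tensor k (tensor_power k B x) M (power_tensor k B as) m))"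

lemma rw_gen_eq:
  "length as = x \<Longrightarrow> rw_gen k B M n (fs, as, m)
    = direct_sum_incl {1..} (rw_summand k B M n) x (rw_summand_gen k B M n x (fs, as, m))"
  by (auto simp: rw_gen_def rw_summand_gen_def Let_def)

lemma rw_gen_multilinear:
  assumes B: "module k B" and M: "module k M" and fs: "fs \<in> nerve_strings n x 1"
  shows "rw_multilinear k B M x (rw_module k B M n) (\<lambda>as m. rw_gen k B M n (fs, as, m))"
proof -
  interpret B: module k B by fact
  let ?S = "nerve_strings n x 1" and ?T = "tensor_power k B x"
  let ?F = "free_module k ?S" and ?TM = "tensor_product k ?T M"
  note T = tensor_power_module[OF B, of x] and TM = tensor_product_module[OF tensor_power_module[OF B] M, of x]
  note F = free_module_module[OF B.R.is_cring, of ?S]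
  have outer: "k_linear k ?TM (rw_module k B M n) (\<lambda>y. direct_sum_incl {1..} (rw_summand k B M n) x
      (pure_tensor k ?F ?TM (free_basis k ?S fs) y))"
    unfolding rw_module_def
    by (rule k_linear_comp[OF pure_tensor_linear_right[OF F TM free_basis_closed[OF B.R.is_cring fs]],
          folded rw_summand_def])
       (rule direct_sum_incl_linear[OF rw_summand_module[OF B M]])
  have pt: "power_tensor k B as \<in> carrier ?T" if "as \<in> tuples B x" for as
    using power_tensor_multilinear[OF B, of x] that by (auto simp: multilinear_def)
  have in_as: "k_linear k ?T (rw_module k B M n) (\<lambda>t. direct_sum_incl {1..} (rw_summand k B M n) x
      (pure_tensor k ?F ?TM (free_basis k ?S fs) (pure_tensor k ?T M t m)))" if "m \<in> carrier M" for m
    by (rule k_linear_comp[OF pure_tensor_linear_left[OF T M that] outer])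
  have in_m: "k_linear k M (rw_module k B M n) (\<lambda>m. direct_sum_incl {1..} (rw_summand k B M n) x
      (pure_tensor k ?F ?TM (free_basis k ?S fs) (pure_tensor k ?T M t m)))" if "t \<in> carrier ?T" for t
    by (rule k_linear_comp[OF pure_tensor_linear_right[OF T M that] outer])
  have eq: "rw_gen k B M n (fs, as, m) = direct_sum_incl {1..} (rw_summand k B M n) x
      (pure_tensor k ?F ?TM (free_basis k ?S fs) (pure_tensor k ?T M (power_tensor k B as) m))"
    if "as \<in> tuples B x" for as m
    using that by (simp add: rw_gen_eq[of as x] tuples_def rw_summand_gen_def)
  show ?thesis
    unfolding rw_multilinear_def multilinear_def
  proof (intro conjI ballI allI impI)
    fix as m assume as: "as \<in> tuples B x" and m: "m \<in> carrier M"
    show "rw_gen k B M n (fs, as, m) \<in> carrier (rw_module k B M n)"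
      unfolding eq[OF as] by (rule k_linear_closed[OF in_as[OF m] pt[OF as]])
    fix i assume i: "i < x"
    have "k_linear k B ?T (\<lambda>a. power_tensor k B (as[i := a]))"
      using power_tensor_multilinear[OF B, of x] as i by (auto simp: multilinear_def)
    from k_linear_comp[OF this in_as[OF m]]
    show "k_linear k B (rw_module k B M n) (\<lambda>a. rw_gen k B M n (fs, as[i := a], m))"
      by (rule k_linear_cong[OF _ B]) (simp add: eq tuples_update[OF as])
  next
    fix as assume as: "as \<in> tuples B x"
    show "k_linear k M (rw_module k B M n) (\<lambda>m. rw_gen k B M n (fs, as, m))"
      unfolding eq[OF as] by (rule in_m[OF pt[OF as]])
  qed
qed

text \<open>
  It is enough to let the entries \<open>a\<^sub>i\<close> run through generators of \<open>B\<close>.  For \<open>I \<union> {1}\<close> as generators of \<open>A\<close>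
  this says that the generators with basic tensors suffice.
\<close>

lemma rw_gen_generates:
  assumes B: "module k B" and M: "module k M" and G: "generates k B G"
  shows "generates k (rw_module k B M n)
    (rw_gen k B M n ` {(fs, as, m) \<in> rw_indices B M n. set as \<subseteq> G})"
proof -
  interpret B: module k B by fact
  have G_sub: "G \<subseteq> carrier B" using G by (auto simp: generates_def)
  define I where "I x = {(fs, as, m) \<in> rw_indices B M n. set as \<subseteq> G \<and> length as = x}" for x
  have "generates k (rw_summand k B M n x) (rw_summand_gen k B M n x ` I x)" if x: "1 \<le> x" for x
  proof -
    let ?S = "nerve_strings n x 1" and ?T = "tensor_power k B x"
    let ?F = "free_module k ?S" and ?TM = "tensor_product k ?T M"
    let ?Gp = "{as. length as = x \<and> set as \<subseteq> G}"
    let ?GT = "(\<lambda>(t, m). pure_tensor k ?T M t m) ` (power_tensor k B ` ?Gp \<times> carrier M)"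
    have "generates k (tensor_product k ?F ?TM)
        ((\<lambda>(u, w). pure_tensor k ?F ?TM u w) ` (free_basis k ?S ` ?S \<times> ?GT))"
      by (intro tensor_generates tensor_product_module free_module_module tensor_power_module
          tensor_power_generates free_module_generates generates_carrier B M G B.R.is_cring)
    moreover have "(\<lambda>(u, w). pure_tensor k ?F ?TM u w) ` (free_basis k ?S ` ?S \<times> ?GT)
        = rw_summand_gen k B M n x ` I x"
      using x G_sub unfolding I_def rw_indices_def rw_summand_gen_def
      by (force simp: image_iff)
    ultimately show ?thesis by (simp add: rw_summand_def)
  qed
  then have "generates k (rw_module k B M n)
      (\<Union>x\<in>{1..}. direct_sum_incl {1..} (rw_summand k B M n) x ` rw_summand_gen k B M n x ` I x)"
    unfolding rw_module_def
    by (intro direct_sum_generates rw_summand_module B M B.R.is_cring) auto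
  moreover have "(\<Union>x\<in>{1..}. direct_sum_incl {1..} (rw_summand k B M n) x ` rw_summand_gen k B M n x ` I x)
      = (\<Union>x\<in>{1..}. rw_gen k B M n ` I x)"
    unfolding image_image by (intro SUP_cong image_cong refl) (auto simp: I_def rw_gen_eq)
  moreover have "\<dots> = rw_gen k B M n ` (\<Union>x\<in>{1..}. I x)" by auto
  moreover have "(\<Union>x\<in>{1..}. I x) = {(fs, as, m) \<in> rw_indices B M n. set as \<subseteq> G}"
    unfolding I_def rw_indices_def by auto
  ultimately show ?thesis by simp
qed

text \<open>
  The tensor factors are split off from the inside out: a multilinear map on tuples extends to the
  tensor power, then to its tensor product with \<open>M\<close>, and a family of maps indexed by the strings
  extends to the free module and, over all lengths, to the direct sum.
\<close>

lemma rw_lift: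
  assumes B: "module k B" and M: "module k M" and P: "module k P"
    and \<phi>: "\<And>x fs. \<lbrakk>1 \<le> x; fs \<in> nerve_strings n x 1\<rbrakk> \<Longrightarrow> rw_multilinear k B M x P (\<phi> fs)"
  shows "\<exists>F. k_linear k (rw_module k B M n) P F \<and>
    (\<forall>(fs, as, m)\<in>rw_indices B M n. F (rw_gen k B M n (fs, as, m)) = \<phi> fs as m)"
proof -
  interpret B: module k B by fact
  have "\<exists>H. k_linear k (rw_summand k B M n x) P H \<and>
      (\<forall>fs\<in>nerve_strings n x 1. \<forall>as\<in>tuples B x. \<forall>m\<in>carrier M.
        H (rw_summand_gen k B M n x (fs, as, m)) = \<phi> fs as m)" if x: "1 \<le> x" for x
  proof -
    let ?S = "nerve_strings n x 1" and ?T = "tensor_power k B x"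
    let ?F = "free_module k ?S" and ?TM = "tensor_product k ?T M"
    note T = tensor_power_module[OF B, of x] and TM = tensor_product_module[OF tensor_power_module[OF B] M, of x]
    note F = free_module_module[OF B.R.is_cring, of ?S]
    have "\<exists>h. k_linear k ?TM P h \<and>
        (\<forall>as\<in>tuples B x. \<forall>m\<in>carrier M. h (pure_tensor k ?T M (power_tensor k B as) m) = \<phi> fs as m)"
      if fs: "fs \<in> ?S" for fs
      using \<phi>[OF x fs]
      by (intro tensor_lift_generators T M P tuples_power_generates B tensor_power_lift)
         (auto simp: rw_multilinear_def)
    then obtain h where h: "\<And>fs. fs \<in> ?S \<Longrightarrow> k_linear k ?TM P (h fs)"
      and h_gen: "\<And>fs as m. \<lbrakk>fs \<in> ?S; as \<in> tuples B x; m \<in> carrier M\<rbrakk>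
        \<Longrightarrow> h fs (pure_tensor k ?T M (power_tensor k B as) m) = \<phi> fs as m"
      by metis
    have "\<exists>H. k_linear k (tensor_product k ?F ?TM) P H \<and>
        (\<forall>fs\<in>?S. \<forall>y\<in>carrier ?TM. H (pure_tensor k ?F ?TM (free_basis k ?S fs) y) = h fs y)"
      by (intro tensor_lift_generators F TM P free_module_generates B.R.is_cring free_module_lift h)
         (auto intro: k_linear_closed[OF h])
    then obtain H where H: "k_linear k (tensor_product k ?F ?TM) P H"
      "\<And>fs y. \<lbrakk>fs \<in> ?S; y \<in> carrier ?TM\<rbrakk> \<Longrightarrow> H (pure_tensor k ?F ?TM (free_basis k ?S fs) y) = h fs y"
      by blast
    have pt: "power_tensor k B as \<in> carrier ?T" if "as \<in> tuples B x" for as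
      using power_tensor_multilinear[OF B, of x] that by (auto simp: multilinear_def)
    show ?thesis
      using H h_gen pure_tensor_closed[OF T M pt]
      by (intro exI[of _ H]) (simp add: rw_summand_gen_def rw_summand_def)
  qed
  then obtain H where H: "\<And>x. 1 \<le> x \<Longrightarrow> k_linear k (rw_summand k B M n x) P (H x)"
    and H_gen: "\<And>x fs as m. \<lbrakk>1 \<le> x; fs \<in> nerve_strings n x 1; as \<in> tuples B x; m \<in> carrier M\<rbrakk>
      \<Longrightarrow> H x (rw_summand_gen k B M n x (fs, as, m)) = \<phi> fs as m"
    by metis
  obtain F where F: "k_linear k (rw_module k B M n) P F"
    "\<And>x u. \<lbrakk>1 \<le> x; u \<in> carrier (rw_summand k B M n x)\<rbrakk>
      \<Longrightarrow> F (direct_sum_incl {1..} (rw_summand k B M n) x u) = H x u"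
    using direct_sum_lift[of k "{1..}" "rw_summand k B M n" P H, OF B.R.is_cring rw_summand_module[OF B M] P] H
    unfolding rw_module_def by auto
  have "rw_summand_gen k B M n x (fs, as, m) \<in> carrier (rw_summand k B M n x)"
    if "fs \<in> nerve_strings n x 1" "as \<in> tuples B x" "m \<in> carrier M" for x fs as m
  proof -
    have pt: "power_tensor k B as \<in> carrier (tensor_power k B x)"
      using power_tensor_multilinear[OF B, of x] that by (auto simp: multilinear_def)
    show ?thesis
      unfolding rw_summand_gen_def rw_summand_def prod.case
      by (intro pure_tensor_closed free_module_module tensor_product_module tensor_power_module
          free_basis_closed B M B.R.is_cring pt that)
  qed
  then show ?thesis
    using F H_gen by (intro exI[of _ F]) (auto simp: rw_indices_def rw_gen_eq tuples_def)
qed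

section \<open>Pruned strings of surjections and subtuples\<close>

text \<open>
  \<^const>\<open>reindex\<close> expresses the order isomorphism \<open>T \<cong> {1..card T}\<close> by counting the elements up to \<open>t\<close>.
\<close>

lemma rank_image:
  fixes T :: "nat set"
  assumes T: "finite T"
  shows "(\<lambda>t. card {s \<in> T. s \<le> t}) ` T = {1..card T}"
proof (rule card_subset_eq)
  let ?r = "\<lambda>t. card {s \<in> T. s \<le> t}"
  have mono: "?r t < ?r t'" if "t' \<in> T" "t < t'" for t t'
  proof (rule psubset_card_mono)
    show "{s \<in> T. s \<le> t} \<subset> {s \<in> T. s \<le> t'}"
    proof (rule psubsetI)
      have "t' \<in> {s \<in> T. s \<le> t'}" "t' \<notin> {s \<in> T. s \<le> t}" using that by auto
      then show "{s \<in> T. s \<le> t} \<noteq> {s \<in> T. s \<le> t'}" by blast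
    qed (use that in auto)
  qed (simp add: T)
  have "inj_on ?r T"
  proof (rule inj_onI)
    fix t t' assume "t \<in> T" "t' \<in> T" "?r t = ?r t'"
    then show "t = t'" using mono[of t' t] mono[of t t'] by (cases t t' rule: linorder_cases) auto
  qed
  then show "card (?r ` T) = card {1..card T}" by (simp add: card_image)
  have "1 \<le> ?r t" if "t \<in> T" for t
    using T that card_gt_0_iff[of "{s \<in> T. s \<le> t}"] by force
  moreover have "?r t \<le> card T" for t by (intro card_mono T) auto
  ultimately show "?r ` T \<subseteq> {1..card T}" by auto
qed simp

lemma sorted_list_image:
  fixes S :: "nat set"
  assumes "finite S"
  shows "(\<lambda>j. sorted_list_of_set S ! (j - 1)) ` {1..card S} = S"
proof -
  let ?xs = "sorted_list_of_set S"
  have "(\<lambda>j. ?xs ! (j - 1)) ` {1..card S} = (\<lambda>j. ?xs ! (j - 1)) ` Suc ` {..<card S}"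
    by (simp only: image_Suc_lessThan)
  also have "\<dots> = (!) ?xs ` {..<length ?xs}" by (simp add: image_image)
  also have "\<dots> = set ?xs" by (auto simp: set_conv_nth)
  finally show ?thesis using assms by simp
qed

lemma reindex_surjection:
  assumes "finite S"
  shows "reindex S (f ` S) f \<in> surjections (card S) (card (f ` S))"
proof -
  have "reindex S (f ` S) f ` {1..card S}
      = (\<lambda>t. card {s \<in> f ` S. s \<le> t}) ` f ` (\<lambda>j. sorted_list_of_set S ! (j - 1)) ` {1..card S}"
    unfolding reindex_def by (simp add: image_image)
  also have "\<dots> = {1..card (f ` S)}"
    using assms by (simp only: sorted_list_image rank_image finite_imageI)
  finally have im: "reindex S (f ` S) f ` {1..card S} = {1..card (f ` S)}" .
  then have "reindex S (f ` S) f \<in> {1..card S} \<rightarrow>\<^sub>E {1..card (f ` S)}"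
    by (auto simp: PiE_iff reindex_def)
  with im show ?thesis by (simp add: surjections_def)
qed

text \<open>
  Restricting a string to a nonempty set of leaves and their images gives again a string of
  surjections, and it still ends at \<open>1\<close> because the last image is nonempty.
\<close>

lemma prune_nerve_strings:
  assumes "fs \<in> nerve_strings n x 1" "L \<subseteq> {1..x}" "L \<noteq> {}"
  shows "prune L fs \<in> nerve_strings n (card L) 1"
  using assms
proof (induction n arbitrary: fs x L)
  case 0
  then have "x = 1" "fs = []" by (auto split: if_splits)
  moreover from this have "L = {1}" using 0 by auto
  ultimately show ?case by simp
next
  case (Suc n)
  then obtain f gs y where fs: "fs = f # gs" "f \<in> surjections x y" "gs \<in> nerve_strings n y 1"
    by auto
  have fin: "finite L" using Suc.prems(2) finite_subset by blast
  have "f ` L \<subseteq> {1..y}" using fs(2) Suc.prems(2) by (auto simp: surjections_def)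
  with Suc.IH[OF fs(3)] Suc.prems(3) have "prune (f ` L) gs \<in> nerve_strings n (card (f ` L)) 1" by simp
  moreover have "1 \<le> card (f ` L)" using fin Suc.prems(3) by (simp add: Suc_leI card_gt_0_iff)
  ultimately show ?case using reindex_surjection[OF fin, of f] fs(1) by auto
qed

lemma sorted_list_of_set_from_1: "sorted_list_of_set {Suc 0..x} = [Suc 0..<Suc x]"
  using sorted_list_of_set_range[of "Suc 0" "Suc x"] by (simp only: atLeastLessThanSuc_atLeastAtMost)

text \<open>
  Pruning with all leaves kept changes nothing: the maps in a string are surjective, so each image is
  the whole object, and the order isomorphisms in \<^const>\<open>reindex\<close> are identities.
\<close>

lemma prune_full:
  assumes "fs \<in> nerve_strings n x z"
  shows "prune {1..x} fs = fs"
  using assms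
proof (induction n arbitrary: fs x)
  case 0
  then show ?case by (auto split: if_splits)
next
  case (Suc n)
  then obtain f gs y where fs: "fs = f # gs" "f \<in> surjections x y" "gs \<in> nerve_strings n y z"
    by auto
  have f: "f \<in> {1..x} \<rightarrow>\<^sub>E {1..y}" "f ` {1..x} = {1..y}" using fs(2) by (auto simp: surjections_def)
  have "reindex {1..x} {1..y} f j = f j" for j
  proof (cases "j \<in> {1..x}")
    case True
    then have "f j \<le> y" using f(1) by auto
    then have "{t \<in> {1..y}. t \<le> f j} = {1..f j}" by auto
    then show ?thesis using True by (simp add: reindex_def sorted_list_of_set_from_1 del: upt_Suc)
  next
    case False
    then show ?thesis using f(1) by (auto simp: reindex_def PiE_iff extensional_def)
  qed
  then show ?case using f(2) Suc.IH[OF fs(3)] fs(1) by (simp add: fun_eq_iff)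
qed

lemma length_subtuple: "length (subtuple L as) = card L"
  by (simp add: subtuple_def)

lemma subtuple_full: "subtuple {1..length as} as = as"
  by (rule nth_equalityI) (auto simp: subtuple_def sorted_list_of_set_from_1 simp del: upt_Suc)

lemma subtuple_subset:
  assumes "L \<subseteq> {1..length as}"
  shows "set (subtuple L as) \<subseteq> set as"
proof -
  have "finite L" using assms finite_subset by blast
  then show ?thesis using assms by (force simp: subtuple_def)
qed

lemma subtuple_update_outside:
  assumes "Suc i \<notin> L" "L \<subseteq> {1..}"
  shows "subtuple L (as[i := a]) = subtuple L as"
proof (cases "finite L")
  case True
  have "as[i := a] ! (l - 1) = as ! (l - 1)" if "l \<in> L" for l
  proof -
    have "l - 1 \<noteq> i" using assms that by (cases l) auto
    then show ?thesis by simp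
  qed
  then show ?thesis using True by (simp add: subtuple_def)
qed (simp add: subtuple_def)

text \<open>
  Linearity in the \<open>i\<close>-th entry of a tuple becomes linearity in some entry of the subtuple.  Here
  list positions start at 0 and indices of tensor factors at 1.
\<close>

lemma subtuple_update_inside:
  assumes "Suc i \<in> L" "finite L" "L \<subseteq> {1..length as}"
  shows "\<exists>p<card L. \<forall>a. subtuple L (as[i := a]) = (subtuple L as)[p := a]"
proof -
  let ?xs = "sorted_list_of_set L"
  obtain p where p: "p < length ?xs" "?xs ! p = Suc i"
    using assms(1,2) in_set_conv_nth[of "Suc i" ?xs] by auto
  have "subtuple L (as[i := a]) = (subtuple L as)[p := a]" for a
  proof (rule nth_equalityI)
    fix j assume "j < length (subtuple L (as[i := a]))"
    then have j: "j < length ?xs" by (simp add: subtuple_def)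
    then have "?xs ! j \<in> L" using assms(2) nth_mem[OF j] by simp
    then have xj: "1 \<le> ?xs ! j" "?xs ! j \<le> length as" using assms(3) by auto
    show "subtuple L (as[i := a]) ! j = (subtuple L as)[p := a] ! j"
    proof (cases "j = p")
      case True
      then show ?thesis using p j xj by (simp add: subtuple_def)
    next
      case False
      then have "?xs ! j \<noteq> Suc i" using p j nth_eq_iff_index_eq[of ?xs j p] by simp
      then have "?xs ! j - 1 \<noteq> i" using xj(1) by auto
      then show ?thesis using False j by (simp add: subtuple_def)
    qed
  qed (simp add: subtuple_def)
  then show ?thesis using p(1) by auto
qed

section \<open>The augmentation ideal\<close>

lemma augmented_algebraD:
  assumes "augmented_algebra k A \<epsilon>"
  shows "cring k" and "cring A" and "module k A" and "\<epsilon> \<in> ring_hom A k"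
    and "\<lbrakk>c \<in> carrier k; a \<in> carrier A\<rbrakk> \<Longrightarrow> \<epsilon> (c \<odot>\<^bsub>A\<^esub> a) = c \<otimes>\<^bsub>k\<^esub> \<epsilon> a"
proof -
  interpret augmented_algebra k A \<epsilon> by fact
  show "cring k" "cring A" "module k A" by (rule R_cring M_cring module)+
  show "\<epsilon> \<in> ring_hom A k" by (rule augmentation_hom)
  show "\<epsilon> (c \<odot>\<^bsub>A\<^esub> a) = c \<otimes>\<^bsub>k\<^esub> \<epsilon> a" if "c \<in> carrier k" "a \<in> carrier A"
    using that by (rule augmentation_smult)
qed

lemma augmentation_linear:
  assumes "augmented_algebra k A \<epsilon>"
  shows "k_linear k A (regular_module k) \<epsilon>"
proof -
  interpret k: cring k by (rule augmented_algebraD(1)[OF assms(1)])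
  interpret A: cring A by (rule augmented_algebraD(2)[OF assms(1)])
  interpret Am: module k A by (rule augmented_algebraD(3)[OF assms(1)])
  show ?thesis
    using augmented_algebraD(4)[OF assms(1)] augmented_algebraD(5)[OF assms(1)]
    by (intro k_linearI) (auto simp: regular_module_simps ring_hom_closed ring_hom_add)
qed

lemma augmentation_ideal_simps:
  "carrier (augmentation_ideal k A \<epsilon>) = {a \<in> carrier A. \<epsilon> a = \<zero>\<^bsub>k\<^esub>}"
  "\<zero>\<^bsub>augmentation_ideal k A \<epsilon>\<^esub> = \<zero>\<^bsub>A\<^esub>"
  "a \<oplus>\<^bsub>augmentation_ideal k A \<epsilon>\<^esub> b = a \<oplus>\<^bsub>A\<^esub> b"
  "c \<odot>\<^bsub>augmentation_ideal k A \<epsilon>\<^esub> a = c \<odot>\<^bsub>A\<^esub> a"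
  by (auto simp: augmentation_ideal_def a_kernel_def kernel_def)

lemma augmentation_ideal_module:
  assumes "augmented_algebra k A \<epsilon>"
  shows "module k (augmentation_ideal k A \<epsilon>)"
proof -
  interpret k: cring k by (rule augmented_algebraD(1)[OF assms(1)])
  interpret A: cring A by (rule augmented_algebraD(2)[OF assms(1)])
  interpret Am: module k A by (rule augmented_algebraD(3)[OF assms(1)])
  have A: "module k A" by (rule Am.module_axioms)
  have K: "module k (regular_module k)" by (rule regular_module_module[OF k.is_cring])
  interpret K: module k "regular_module k" by fact
  have "submodule {\<zero>\<^bsub>regular_module k\<^esub>} k (regular_module k)" by (rule K.submoduleI) auto
  then have "submodule {a \<in> carrier A. \<epsilon> a \<in> {\<zero>\<^bsub>regular_module k\<^esub>}} k A"
    by (rule submodule_vimage[OF augmentation_linear[OF assms] A K])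
  moreover have "{a \<in> carrier A. \<epsilon> a \<in> {\<zero>\<^bsub>regular_module k\<^esub>}} = a_kernel A k \<epsilon>"
    by (auto simp: a_kernel_def kernel_def regular_module_simps)
  ultimately show ?thesis
    unfolding augmentation_ideal_def by (simp add: submodule.submodule_is_module A)
qed

text \<open>
  The projection of \<open>A = I \<oplus> k\<close> onto \<open>I\<close>.
\<close>

definition reduce :: "('k, 'a) module \<Rightarrow> ('a \<Rightarrow> 'k) \<Rightarrow> 'a \<Rightarrow> 'a"
  where "reduce A \<epsilon> a = a \<ominus>\<^bsub>A\<^esub> \<epsilon> a \<odot>\<^bsub>A\<^esub> \<one>\<^bsub>A\<^esub>"

lemma reduce_linear:
  assumes "augmented_algebra k A \<epsilon>"
  shows "k_linear k A (augmentation_ideal k A \<epsilon>) (reduce A \<epsilon>)"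
proof -
  interpret k: cring k by (rule augmented_algebraD(1)[OF assms(1)])
  interpret A: cring A by (rule augmented_algebraD(2)[OF assms(1)])
  interpret Am: module k A by (rule augmented_algebraD(3)[OF assms(1)])
  have A: "module k A" by (rule Am.module_axioms)
  have K: "module k (regular_module k)" by (rule regular_module_module[OF k.is_cring])
  note lin = augmentation_linear[OF assms]
  have cl: "\<epsilon> a \<in> carrier k" if "a \<in> carrier A" for a
    using k_linear_closed[OF lin that] by (simp add: regular_module_simps)
  have one: "\<epsilon> \<one>\<^bsub>A\<^esub> = \<one>\<^bsub>k\<^esub>" using augmented_algebraD(4)[OF assms(1)] by (rule ring_hom_one)
  have "k_linear k A A (\<lambda>a. \<epsilon> a \<odot>\<^bsub>A\<^esub> \<one>\<^bsub>A\<^esub>)"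
    by (rule k_linear_comp[OF lin])
       (auto intro!: k_linearI simp: regular_module_simps Am.smult_l_distr Am.smult_assoc1)
  then have "k_linear k A A (\<lambda>a. (\<ominus>\<^bsub>k\<^esub> \<one>\<^bsub>k\<^esub>) \<odot>\<^bsub>A\<^esub> (\<epsilon> a \<odot>\<^bsub>A\<^esub> \<one>\<^bsub>A\<^esub>))"
    by (rule k_linear_scale) (auto intro: A)
  moreover have "k_linear k A A (\<lambda>a. a)" by (rule k_linearI) auto
  ultimately have "k_linear k A A (\<lambda>a. a \<oplus>\<^bsub>A\<^esub> (\<ominus>\<^bsub>k\<^esub> \<one>\<^bsub>k\<^esub>) \<odot>\<^bsub>A\<^esub> (\<epsilon> a \<odot>\<^bsub>A\<^esub> \<one>\<^bsub>A\<^esub>))"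
    by (intro k_linear_plus A)
  then have red: "k_linear k A A (reduce A \<epsilon>)"
    by (rule k_linear_cong[OF _ A]) (simp add: reduce_def a_minus_def Am.smult_l_minus cl)
  moreover have "\<epsilon> (reduce A \<epsilon> a) = \<zero>\<^bsub>k\<^esub>" if a: "a \<in> carrier A" for a
  proof -
    have "\<epsilon> (reduce A \<epsilon> a) = \<epsilon> a \<ominus>\<^bsub>regular_module k\<^esub> \<epsilon> a \<otimes>\<^bsub>k\<^esub> \<one>\<^bsub>k\<^esub>"
      unfolding reduce_def
      using k_linear_diff[OF lin A K a, of "\<epsilon> a \<odot>\<^bsub>A\<^esub> \<one>\<^bsub>A\<^esub>"] a cl[OF a] augmented_algebraD(5)[OF assms(1)] one by simp
    also have "\<dots> = \<zero>\<^bsub>regular_module k\<^esub>"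
      using abelian_group.r_neg[OF module.axioms(2)[OF K], of "\<epsilon> a"] cl[OF a]
      by (simp add: a_minus_def regular_module_simps)
    finally show ?thesis by (simp add: regular_module_simps)
  qed
  ultimately show ?thesis unfolding k_linear_def augmentation_ideal_simps by auto
qed

lemma reduce_ideal:
  assumes "augmented_algebra k A \<epsilon>" "a \<in> carrier (augmentation_ideal k A \<epsilon>)"
  shows "reduce A \<epsilon> a = a"
proof -
  interpret k: cring k by (rule augmented_algebraD(1)[OF assms(1)])
  interpret A: cring A by (rule augmented_algebraD(2)[OF assms(1)])
  interpret Am: module k A by (rule augmented_algebraD(3)[OF assms(1)])
  show ?thesis using assms(2) by (simp add: reduce_def augmentation_ideal_simps a_minus_def)
qed

lemma reduce_one:
  assumes "augmented_algebra k A \<epsilon>"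
  shows "reduce A \<epsilon> \<one>\<^bsub>A\<^esub> = \<zero>\<^bsub>A\<^esub>"
proof -
  interpret k: cring k by (rule augmented_algebraD(1)[OF assms(1)])
  interpret A: cring A by (rule augmented_algebraD(2)[OF assms(1)])
  interpret Am: module k A by (rule augmented_algebraD(3)[OF assms(1)])
  have "\<epsilon> \<one>\<^bsub>A\<^esub> = \<one>\<^bsub>k\<^esub>" using augmented_algebraD(4)[OF assms(1)] by (rule ring_hom_one)
  then show ?thesis by (simp add: reduce_def a_minus_def A.r_neg)
qed

lemma ideal_and_one_generate:
  assumes "augmented_algebra k A \<epsilon>"
  shows "generates k A (carrier (augmentation_ideal k A \<epsilon>) \<union> {\<one>\<^bsub>A\<^esub>})"
  unfolding generates_def
proof (intro conjI allI impI subsetI)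
  interpret k: cring k by (rule augmented_algebraD(1)[OF assms(1)])
  interpret A: cring A by (rule augmented_algebraD(2)[OF assms(1)])
  interpret Am: module k A by (rule augmented_algebraD(3)[OF assms(1)])
  have A: "module k A" by (rule Am.module_axioms)
  show "a \<in> carrier A" if "a \<in> carrier (augmentation_ideal k A \<epsilon>) \<union> {\<one>\<^bsub>A\<^esub>}" for a
    using that by (auto simp: augmentation_ideal_simps)
  fix U a assume U: "submodule U k A" "carrier (augmentation_ideal k A \<epsilon>) \<union> {\<one>\<^bsub>A\<^esub>} \<subseteq> U"
    and a: "a \<in> carrier A"
  have ea: "\<epsilon> a \<in> carrier k" using augmented_algebraD(4)[OF assms(1)] a by (rule ring_hom_closed)
  have "reduce A \<epsilon> a \<in> U" using k_linear_closed[OF reduce_linear[OF assms] a] U(2) by auto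
  moreover have "\<epsilon> a \<odot>\<^bsub>A\<^esub> \<one>\<^bsub>A\<^esub> \<in> U" using Am.submoduleE(4)[OF U(1) ea] U(2) by auto
  ultimately have "reduce A \<epsilon> a \<oplus>\<^bsub>A\<^esub> \<epsilon> a \<odot>\<^bsub>A\<^esub> \<one>\<^bsub>A\<^esub> \<in> U" by (rule Am.submoduleE(5)[OF U(1)])
  moreover have "reduce A \<epsilon> a \<oplus>\<^bsub>A\<^esub> \<epsilon> a \<odot>\<^bsub>A\<^esub> \<one>\<^bsub>A\<^esub> = a"
    using a ea by (simp add: reduce_def a_minus_def A.a_assoc A.l_neg)
  ultimately show "a \<in> U" by simp
qed

section \<open>The pruning map\<close>

text \<open>
  Writing \<open>a\<^sub>l = (a\<^sub>l - \<epsilon>(a\<^sub>l)1) + \<epsilon>(a\<^sub>l)1\<close> in every factor and expanding gives one summand for every set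
  \<open>L\<close> of factors in which the component in \<open>I\<close> is chosen.  The term below is the image of that
  summand under pruning: the trivial factors outside \<open>L\<close> are removed and leave the scalars
  \<open>\<epsilon>(a\<^sub>l)\<close> behind.
\<close>

definition pruning_term ::
    "'k ring \<Rightarrow> ('k, 'a) module \<Rightarrow> ('a \<Rightarrow> 'k) \<Rightarrow> ('k, 'm) module \<Rightarrow> nat
      \<Rightarrow> nat set \<Rightarrow> string_\<Omega> \<Rightarrow> 'a list \<Rightarrow> 'm \<Rightarrow> ('k, 'a, 'm) rw_elem"
  where "pruning_term k A \<epsilon> M n L fs as m =
    (\<Otimes>\<^bsub>k\<^esub>l\<in>{1..length as} - L. \<epsilon> (as ! (l - 1)))
      \<odot>\<^bsub>rw_module k (augmentation_ideal k A \<epsilon>) M n\<^esub>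
    rw_gen k (augmentation_ideal k A \<epsilon>) M n (prune L fs, map (reduce A \<epsilon>) (subtuple L as), m)"

text \<open>
  The empty set is excluded since tensors with only trivial factors are sent to \<open>0\<close>.
\<close>

definition pruning_subsets :: "nat \<Rightarrow> nat set set"
  where "pruning_subsets x = {L. L \<subseteq> {1..x} \<and> L \<noteq> {}}"

text \<open>
  Each entry of the tuple enters exactly once, linearly: through \<^const>\<open>reduce\<close> as a factor of the
  pruned tensor if its index is in \<open>L\<close>, and through the scalar \<open>\<epsilon>(a)\<close> otherwise.
\<close>

lemma pruning_term_multilinear:
  assumes AA: "augmented_algebra k A \<epsilon>" and M: "module k M"
    and fs: "fs \<in> nerve_strings n x 1" and L: "L \<in> pruning_subsets x"
  shows "rw_multilinear k A M x (rw_module k (augmentation_ideal k A \<epsilon>) M n)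
    (pruning_term k A \<epsilon> M n L fs)"
proof -
  interpret k: cring k by (rule augmented_algebraD(1)[OF assms(1)])
  interpret A: cring A by (rule augmented_algebraD(2)[OF assms(1)])
  interpret Am: module k A by (rule augmented_algebraD(3)[OF assms(1)])
  have A: "module k A" by (rule Am.module_axioms)
  let ?I = "augmentation_ideal k A \<epsilon>"
  note I = augmentation_ideal_module[OF AA]
  let ?P = "rw_module k ?I M n"
  note P = rw_module_module[OF I M, of n]
  interpret P: module k ?P by fact
  note \<epsilon> = augmentation_linear[OF AA]
  note red = reduce_linear[OF AA]
  have L': "L \<subseteq> {1..x}" "L \<noteq> {}" and finL: "finite L"
    using L finite_subset by (auto simp: pruning_subsets_def)
  note ml = rw_gen_multilinear[OF I M prune_nerve_strings[OF fs L'], unfolded rw_multilinear_def multilinear_def]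
  have \<epsilon>c: "\<epsilon> a \<in> carrier k" if "a \<in> carrier A" for a
    using k_linear_closed[OF \<epsilon> that] by (simp add: regular_module_simps)
  have tup: "map (reduce A \<epsilon>) (subtuple L as) \<in> tuples ?I (card L)" if as: "as \<in> tuples A x" for as
  proof -
    have "set (subtuple L as) \<subseteq> carrier A" using subtuple_subset[of L as] L' as by (auto simp: tuples_def)
    then show ?thesis using k_linear_closed[OF red] by (auto simp: tuples_def length_subtuple)
  qed
  have entry: "as ! (l - 1) \<in> carrier A" if "as \<in> tuples A x" "l \<in> {1..x}" for as l
    using that nth_mem[of "l - 1" as] by (auto simp: tuples_def)
  have coef: "(\<Otimes>\<^bsub>k\<^esub>l\<in>X. \<epsilon> (as ! (l - 1))) \<in> carrier k"
    if "as \<in> tuples A x" "X \<subseteq> {1..x}" for X as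
    using entry that \<epsilon>c by (intro k.finprod_closed) blast
  let ?g = "\<lambda>as m. rw_gen k ?I M n (prune L fs, map (reduce A \<epsilon>) (subtuple L as), m)"
  have gc: "?g as m \<in> carrier ?P" if "as \<in> tuples A x" "m \<in> carrier M" for as m
    using ml tup[OF that(1)] that(2) by blast
  have len: "length as = x" if "as \<in> tuples A x" for as using that by (simp add: tuples_def)
  show ?thesis
    unfolding rw_multilinear_def multilinear_def
  proof (intro conjI ballI allI impI)
    fix as assume as: "as \<in> tuples A x"
    have "k_linear k M ?P (?g as)" using ml tup[OF as] by blast
    then show "k_linear k M ?P (pruning_term k A \<epsilon> M n L fs as)"
      unfolding pruning_term_def by (rule k_linear_scale[OF _ coef[OF as] P]) (simp add: len[OF as])
    fix m assume m: "m \<in> carrier M"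
    show "pruning_term k A \<epsilon> M n L fs as m \<in> carrier ?P"
      unfolding pruning_term_def using coef[OF as, of "{1..x} - L"] gc[OF as m] len[OF as] by simp
    fix i assume i: "i < x"
    note up = tuples_update[OF as]
    show "k_linear k A ?P (\<lambda>a. pruning_term k A \<epsilon> M n L fs (as[i := a]) m)"
    proof (cases "Suc i \<in> L")
      case True
      obtain p where p: "p < card L" "\<And>a. subtuple L (as[i := a]) = (subtuple L as)[p := a]"
        using subtuple_update_inside[OF True finL, of as] L'(1) len[OF as] by auto
      have "k_linear k ?I ?P (\<lambda>b. rw_gen k ?I M n
          (prune L fs, (map (reduce A \<epsilon>) (subtuple L as))[p := b], m))"
        using ml tup[OF as] m p(1) by blast
      from k_linear_scale[OF k_linear_comp[OF red this] coef[OF as, of "{1..x} - L"] P]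
      show ?thesis
      proof (rule k_linear_cong[OF _ A])
        fix a
        have "(\<Otimes>\<^bsub>k\<^esub>l\<in>{1..x} - L. \<epsilon> (as[i := a] ! (l - 1))) = (\<Otimes>\<^bsub>k\<^esub>l\<in>{1..x} - L. \<epsilon> (as ! (l - 1)))"
        proof (rule k.finprod_cong')
          fix l assume "l \<in> {1..x} - L"
          then have "l - 1 \<noteq> i" using True by (cases l) auto
          then show "\<epsilon> (as[i := a] ! (l - 1)) = \<epsilon> (as ! (l - 1))" by simp
        qed (use entry[OF as] \<epsilon>c in auto)
        then show "pruning_term k A \<epsilon> M n L fs (as[i := a]) m
            = (\<Otimes>\<^bsub>k\<^esub>l\<in>{1..x} - L. \<epsilon> (as ! (l - 1))) \<odot>\<^bsub>?P\<^esub> rw_gen k ?I M n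
              (prune L fs, (map (reduce A \<epsilon>) (subtuple L as))[p := reduce A \<epsilon> a], m)"
          by (simp add: pruning_term_def p(2) map_update len[OF as])
      qed simp
    next
      case False
      let ?X = "{1..x} - L - {Suc i}"
      let ?y = "(\<Otimes>\<^bsub>k\<^esub>l\<in>?X. \<epsilon> (as ! (l - 1))) \<odot>\<^bsub>?P\<^esub> ?g as m"
      have c: "(\<Otimes>\<^bsub>k\<^esub>l\<in>?X. \<epsilon> (as ! (l - 1))) \<in> carrier k" by (rule coef[OF as]) auto
      have y: "?y \<in> carrier ?P" using c gc[OF as m] by simp
      have "k_linear k A ?P (\<lambda>a. \<epsilon> a \<odot>\<^bsub>?P\<^esub> ?y)"
        by (rule k_linear_comp[OF \<epsilon>])
           (use y in \<open>auto intro!: k_linearI simp: regular_module_simps P.smult_l_distr P.smult_assoc1\<close>)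
      then show ?thesis
      proof (rule k_linear_cong[OF _ A])
        fix a assume a: "a \<in> carrier A"
        have X: "{1..x} - L = insert (Suc i) ?X" using False i by auto
        have "(\<Otimes>\<^bsub>k\<^esub>l\<in>{1..x} - L. \<epsilon> (as[i := a] ! (l - 1)))
            = \<epsilon> (as[i := a] ! (Suc i - 1)) \<otimes>\<^bsub>k\<^esub> (\<Otimes>\<^bsub>k\<^esub>l\<in>?X. \<epsilon> (as[i := a] ! (l - 1)))"
          by (subst X, rule k.finprod_insert) (use entry[OF up[OF a]] entry[OF up[OF a], of "Suc i"] \<epsilon>c i in auto)
        also have "(\<Otimes>\<^bsub>k\<^esub>l\<in>?X. \<epsilon> (as[i := a] ! (l - 1))) = (\<Otimes>\<^bsub>k\<^esub>l\<in>?X. \<epsilon> (as ! (l - 1)))"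
        proof (rule k.finprod_cong')
          fix l assume "l \<in> ?X"
          then have "l - 1 \<noteq> i" by (cases l) auto
          then show "\<epsilon> (as[i := a] ! (l - 1)) = \<epsilon> (as ! (l - 1))" by simp
        qed (use entry[OF as] \<epsilon>c in auto)
        finally have "(\<Otimes>\<^bsub>k\<^esub>l\<in>{1..x} - L. \<epsilon> (as[i := a] ! (l - 1)))
            = \<epsilon> a \<otimes>\<^bsub>k\<^esub> (\<Otimes>\<^bsub>k\<^esub>l\<in>?X. \<epsilon> (as ! (l - 1)))"
          using i len[OF as] by simp
        moreover have "subtuple L (as[i := a]) = subtuple L as"
          by (rule subtuple_update_outside[OF False]) (use L'(1) in auto)
        ultimately show "pruning_term k A \<epsilon> M n L fs (as[i := a]) m = \<epsilon> a \<odot>\<^bsub>?P\<^esub> ?y"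
          using P.smult_assoc1[OF \<epsilon>c[OF a] c gc[OF as m]] by (simp add: pruning_term_def len[OF as])
      qed
    qed
  qed
qed

lemma rw_multilinear_finsum:
  assumes B: "module k B" and M: "module k M" and P: "module k P" and J: "finite J"
    and ml: "\<And>j. j \<in> J \<Longrightarrow> rw_multilinear k B M x P (\<phi> j)"
  shows "rw_multilinear k B M x P (\<lambda>as m. \<Oplus>\<^bsub>P\<^esub>j\<in>J. \<phi> j as m)"
proof -
  interpret P: module k P by fact
  show ?thesis
    using ml unfolding rw_multilinear_def multilinear_def
    by (auto intro!: P.finsum_closed k_linear_finsum_maps[OF J] B M P)
qed

lemma rw_multilinear_cong:
  assumes ml: "rw_multilinear k B M x P \<phi>" and B: "module k B" and M: "module k M"
    and eq: "\<And>as m. \<lbrakk>as \<in> tuples B x; m \<in> carrier M\<rbrakk> \<Longrightarrow> \<psi> as m = \<phi> as m"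
  shows "rw_multilinear k B M x P \<psi>"
  unfolding rw_multilinear_def multilinear_def
proof (intro conjI ballI allI impI)
  fix as m assume as: "as \<in> tuples B x" and m: "m \<in> carrier M"
  show "\<psi> as m \<in> carrier P" using ml as m eq by (auto simp: rw_multilinear_def multilinear_def)
  fix i assume "i < x"
  then have "k_linear k B P (\<lambda>a. \<phi> (as[i := a]) m)"
    using ml as m by (auto simp: rw_multilinear_def multilinear_def)
  then show "k_linear k B P (\<lambda>a. \<psi> (as[i := a]) m)"
    by (rule k_linear_cong[OF _ B]) (simp add: eq m tuples_update[OF as])
next
  fix as assume as: "as \<in> tuples B x"
  then have "k_linear k M P (\<phi> as)" using ml by (auto simp: rw_multilinear_def)
  then show "k_linear k M P (\<psi> as)" by (rule k_linear_cong[OF _ M]) (simp add: eq as)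
qed

text \<open>
  On a basic tensor only one summand survives, the one for the set \<open>L0\<close> of non-trivial factors.  If
  \<open>l \<in> L0 - L\<close>, then the scalar \<open>\<epsilon>(a\<^sub>l)\<close> is \<open>0\<close>; if \<open>l \<in> L - L0\<close>, then \<open>a\<^sub>l = 1\<close> and the factor
  \<open>a\<^sub>l - \<epsilon>(a\<^sub>l)1\<close> is \<open>0\<close>.  For \<open>L = L0\<close> the scalars are \<open>1\<close> and the factors are unchanged.  Since \<open>1\<close>
  may lie in \<open>I\<close> (over the zero ring), a factor counts as non-trivial by membership in \<open>I\<close>.
\<close>

lemma pruning_terms_basic:
  assumes AA: "augmented_algebra k A \<epsilon>" and M: "module k M"
    and ix: "(fs, as, m) \<in> basic_indices k A \<epsilon> M n"
  shows "(\<Oplus>\<^bsub>rw_module k (augmentation_ideal k A \<epsilon>) M n\<^esub>L\<in>pruning_subsets (length as).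
      pruning_term k A \<epsilon> M n L fs as m) = pruning_gen k A \<epsilon> M n (fs, as, m)"
proof -
  interpret k: cring k by (rule augmented_algebraD(1)[OF assms(1)])
  interpret A: cring A by (rule augmented_algebraD(2)[OF assms(1)])
  interpret Am: module k A by (rule augmented_algebraD(3)[OF assms(1)])
  let ?I = "augmentation_ideal k A \<epsilon>" and ?x = "length as"
  note I = augmentation_ideal_module[OF AA]
  let ?P = "rw_module k ?I M n"
  note P = rw_module_module[OF I M, of n]
  interpret P: module k ?P by fact
  note red = reduce_linear[OF AA]
  have fs: "fs \<in> nerve_strings n ?x 1" and asA: "set as \<subseteq> carrier A" and m: "m \<in> carrier M"
    and basic: "\<And>a. a \<in> set as \<Longrightarrow> a \<in> carrier ?I \<or> a = \<one>\<^bsub>A\<^esub>"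
    using ix by (auto simp: basic_indices_def rw_indices_def)
  have one: "\<epsilon> \<one>\<^bsub>A\<^esub> = \<one>\<^bsub>k\<^esub>" using augmented_algebraD(4)[OF assms(1)] by (rule ring_hom_one)
  define L0 where "L0 = {l \<in> {1..?x}. as ! (l - 1) \<in> carrier ?I}"
  have in_as: "as ! (l - 1) \<in> set as" if "l \<in> {1..?x}" for l using that by (intro nth_mem) auto
  have \<epsilon>c: "\<epsilon> (as ! (l - 1)) \<in> carrier k" if "l \<in> {1..?x}" for l
    using in_as[OF that] asA by (intro ring_hom_closed[OF augmented_algebraD(4)[OF assms(1)]]) auto
  have as: "as \<in> tuples A ?x" using asA by (simp add: tuples_def)
  have cl: "pruning_term k A \<epsilon> M n L fs as m \<in> carrier ?P" if "L \<in> pruning_subsets ?x" for L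
    using pruning_term_multilinear[OF AA M fs that] as m by (auto simp: rw_multilinear_def multilinear_def)
  have fin: "finite (pruning_subsets ?x)"
    by (rule finite_subset[of _ "Pow {1..?x}"]) (auto simp: pruning_subsets_def)
  have zero: "pruning_term k A \<epsilon> M n L fs as m = \<zero>\<^bsub>?P\<^esub>"
    if L: "L \<in> pruning_subsets ?x" and ne: "L \<noteq> L0" for L
  proof -
    have L': "L \<subseteq> {1..?x}" "L \<noteq> {}" using L by (auto simp: pruning_subsets_def)
    have finL: "finite L" using L'(1) finite_subset by blast
    let ?bs = "map (reduce A \<epsilon>) (subtuple L as)"
    have "set (subtuple L as) \<subseteq> carrier A" using subtuple_subset[of L as] L' asA by auto
    then have bs: "?bs \<in> tuples ?I (card L)"
      using k_linear_closed[OF red] by (auto simp: tuples_def length_subtuple)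
    note ml = rw_gen_multilinear[OF I M prune_nerve_strings[OF fs L'], unfolded rw_multilinear_def multilinear_def]
    have g: "rw_gen k ?I M n (prune L fs, ?bs, m) \<in> carrier ?P" using ml bs m by blast
    from ne consider l where "l \<in> L0" "l \<notin> L" | l where "l \<in> L" "l \<notin> L0" by blast
    then show ?thesis
    proof cases
      case 1
      then have l: "l \<in> {1..?x} - L" "\<epsilon> (as ! (l - 1)) = \<zero>\<^bsub>k\<^esub>"
        by (auto simp: L0_def augmentation_ideal_simps)
      let ?X = "{1..?x} - L - {l}"
      have X: "{1..?x} - L = insert l ?X" using l by auto
      have "(\<Otimes>\<^bsub>k\<^esub>l\<in>{1..?x} - L. \<epsilon> (as ! (l - 1)))
          = \<epsilon> (as ! (l - 1)) \<otimes>\<^bsub>k\<^esub> (\<Otimes>\<^bsub>k\<^esub>l\<in>?X. \<epsilon> (as ! (l - 1)))"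
        by (subst X, rule k.finprod_insert) (use l(1) \<epsilon>c in auto)
      also have "\<dots> = \<zero>\<^bsub>k\<^esub>"
        unfolding l(2) by (intro k.l_null k.finprod_closed) (use \<epsilon>c in auto)
      finally show ?thesis using g by (simp add: pruning_term_def)
    next
      case 2
      have l: "l \<in> {1..?x}" using L'(1) 2(1) by blast
      moreover from this 2(2) basic[OF in_as[OF l]] have "as ! (l - 1) = \<one>\<^bsub>A\<^esub>"
        by (simp add: L0_def)
      ultimately have l: "l \<in> {1..?x}" "as ! (l - 1) = \<one>\<^bsub>A\<^esub>" by auto
      then have "Suc (l - 1) \<in> L" using 2 by simp
      then obtain p where p: "p < card L" "\<And>a. subtuple L (as[l - 1 := a]) = (subtuple L as)[p := a]"
        using subtuple_update_inside[of "l - 1" L as] finL L'(1) by blast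
      have "subtuple L as = (subtuple L as)[p := \<one>\<^bsub>A\<^esub>]" using p(2)[of "\<one>\<^bsub>A\<^esub>"] l by (metis list_update_id)
      then have "?bs = ?bs[p := \<zero>\<^bsub>?I\<^esub>]"
        by (metis augmentation_ideal_simps(2) map_update reduce_one[OF AA])
      moreover have "k_linear k ?I ?P (\<lambda>b. rw_gen k ?I M n (prune L fs, ?bs[p := b], m))"
        using ml bs m p(1) by blast
      ultimately have "rw_gen k ?I M n (prune L fs, ?bs, m) = \<zero>\<^bsub>?P\<^esub>"
        using k_linear_zero[OF _ I P] by metis
      then show ?thesis
        unfolding pruning_term_def
        by (simp only:) (intro P.smult_r_null k.finprod_closed, use \<epsilon>c in auto)
    qed
  qed
  have L0_sub: "L0 \<subseteq> {1..?x}" by (auto simp: L0_def)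
  show ?thesis
  proof (cases "L0 = {}")
    case True
    then have "(\<Oplus>\<^bsub>?P\<^esub>L\<in>pruning_subsets ?x. pruning_term k A \<epsilon> M n L fs as m) = \<zero>\<^bsub>?P\<^esub>"
      using zero by (intro P.add.finprod_one_eqI) (auto simp: pruning_subsets_def)
    then show ?thesis
      by (simp only: pruning_gen_def Let_def prod.case L0_def[symmetric] True refl if_True)
  next
    case False
    then have L0: "L0 \<in> pruning_subsets ?x" using L0_sub by (auto simp: pruning_subsets_def)
    have "(\<Oplus>\<^bsub>?P\<^esub>L\<in>pruning_subsets ?x. pruning_term k A \<epsilon> M n L fs as m)
        = (\<Oplus>\<^bsub>?P\<^esub>L\<in>{L0}. pruning_term k A \<epsilon> M n L fs as m)"
      by (rule P.add.finprod_mono_neutral_cong_right) (use L0 fin cl zero in auto)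
    also have "\<dots> = pruning_term k A \<epsilon> M n L0 fs as m" using cl[OF L0] by (simp add: P.finsum_insert)
    also have "\<dots> = rw_gen k ?I M n (prune L0 fs, subtuple L0 as, m)"
    proof -
      have "(\<Otimes>\<^bsub>k\<^esub>l\<in>{1..?x} - L0. \<epsilon> (as ! (l - 1))) = \<one>\<^bsub>k\<^esub>"
      proof (rule k.finprod_one_eqI)
        fix l assume "l \<in> {1..?x} - L0"
        then have "as ! (l - 1) = \<one>\<^bsub>A\<^esub>" using basic in_as by (auto simp: L0_def)
        then show "\<epsilon> (as ! (l - 1)) = \<one>\<^bsub>k\<^esub>" using one by simp
      qed
      moreover have "map (reduce A \<epsilon>) (subtuple L0 as) = subtuple L0 as"
      proof (rule map_idI)
        fix a assume "a \<in> set (subtuple L0 as)"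
        then have "a \<in> carrier ?I" using finite_subset[OF L0_sub] by (auto simp: subtuple_def L0_def)
        then show "reduce A \<epsilon> a = a" by (rule reduce_ideal[OF AA])
      qed
      ultimately have "pruning_term k A \<epsilon> M n L0 fs as m
          = \<one>\<^bsub>k\<^esub> \<odot>\<^bsub>?P\<^esub> rw_gen k ?I M n (prune L0 fs, subtuple L0 as, m)"
        by (simp add: pruning_term_def)
      moreover have "rw_gen k ?I M n (prune L0 fs, subtuple L0 as, m) \<in> carrier ?P"
      proof -
        have "subtuple L0 as \<in> tuples ?I (card L0)"
          using finite_subset[OF L0_sub] by (auto simp: tuples_def length_subtuple, auto simp: subtuple_def L0_def)
        then show ?thesis
          using rw_gen_multilinear[OF I M prune_nerve_strings[OF fs L0_sub False]] m
          by (auto simp: rw_multilinear_def multilinear_def)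
      qed
      ultimately show ?thesis by simp
    qed
    also have "\<dots> = pruning_gen k A \<epsilon> M n (fs, as, m)"
      by (simp only: pruning_gen_def Let_def prod.case L0_def[symmetric] False if_False)
    finally show ?thesis .
  qed
qed

text \<open>
  Existence comes from the multilinear expansion, uniqueness from the fact that \<open>I\<close> and \<open>1\<close> generate
  \<open>A\<close>, so that basic tensors generate the complex.
\<close>

lemma pruning_map_spec:
  assumes AA: "augmented_algebra k A \<epsilon>" and M: "module k M"
  shows "k_linear k (rw_module k A M n) (rw_module k (augmentation_ideal k A \<epsilon>) M n) (pruning_map k A \<epsilon> M n)"
    and "s \<in> basic_indices k A \<epsilon> M n \<Longrightarrow>
      pruning_map k A \<epsilon> M n (rw_gen k A M n s) = pruning_gen k A \<epsilon> M n s"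
proof -
  interpret k: cring k by (rule augmented_algebraD(1)[OF assms(1)])
  interpret A: cring A by (rule augmented_algebraD(2)[OF assms(1)])
  interpret Am: module k A by (rule augmented_algebraD(3)[OF assms(1)])
  have A: "module k A" by (rule Am.module_axioms)
  let ?I = "augmentation_ideal k A \<epsilon>"
  note I = augmentation_ideal_module[OF AA]
  let ?N = "rw_module k A M n" and ?P = "rw_module k ?I M n"
  note N = rw_module_module[OF A M, of n] and P = rw_module_module[OF I M, of n]
  let ?\<phi> = "\<lambda>fs as m. \<Oplus>\<^bsub>?P\<^esub>L\<in>pruning_subsets (length as). pruning_term k A \<epsilon> M n L fs as m"
  have fin: "finite (pruning_subsets x)" for x
    by (rule finite_subset[of _ "Pow {1..x}"]) (auto simp: pruning_subsets_def)
  have "rw_multilinear k A M x ?P (?\<phi> fs)" if "fs \<in> nerve_strings n x 1" for x fs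
    using rw_multilinear_finsum[OF A M P fin pruning_term_multilinear[OF AA M that]]
    by (rule rw_multilinear_cong[OF _ A M]) (simp_all add: tuples_def)
  then obtain F where F: "k_linear k ?N ?P F"
    "\<forall>(fs, as, m)\<in>rw_indices A M n. F (rw_gen k A M n (fs, as, m)) = ?\<phi> fs as m"
    using rw_lift[OF A M P, of n ?\<phi>] by blast
  have basic: "basic_indices k A \<epsilon> M n
      = {(fs, as, m) \<in> rw_indices A M n. set as \<subseteq> carrier ?I \<union> {\<one>\<^bsub>A\<^esub>}}"
    by (auto simp: basic_indices_def)
  have gen: "generates k ?N (rw_gen k A M n ` basic_indices k A \<epsilon> M n)"
    unfolding basic by (rule rw_gen_generates[OF A M ideal_and_one_generate[OF AA]])
  have val: "restrict F (carrier ?N) (rw_gen k A M n s) = pruning_gen k A \<epsilon> M n s"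
    if s: "s \<in> basic_indices k A \<epsilon> M n" for s
  proof -
    obtain fs as m where s_eq: "s = (fs, as, m)" by (cases s)
    have "rw_gen k A M n s \<in> carrier ?N" using gen s unfolding generates_def by auto
    moreover have "F (rw_gen k A M n s) = ?\<phi> fs as m" using F(2) s by (auto simp: basic s_eq)
    ultimately show ?thesis using pruning_terms_basic[OF AA M s[unfolded s_eq]] by (simp add: s_eq)
  qed
  have eq: "pruning_map k A \<epsilon> M n = restrict F (carrier ?N)"
    unfolding pruning_map_def
    by (rule linear_extension_eq[OF N P gen restrict_linear_maps[OF F(1) N]]) (rule val)
  show "k_linear k ?N ?P (pruning_map k A \<epsilon> M n)"
    unfolding eq by (rule k_linear_cong[OF F(1) N]) simp
  show "pruning_map k A \<epsilon> M n (rw_gen k A M n s) = pruning_gen k A \<epsilon> M n s"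
    if "s \<in> basic_indices k A \<epsilon> M n"
    unfolding eq by (rule val[OF that])
qed

text \<open>
  The generators of the complex of \<open>A\<close>, restricted to entries in \<open>I\<close>, satisfy the tensor relations
  over \<open>I\<close> because \<open>I\<close> carries the operations of \<open>A\<close>.
\<close>

lemma rw_inclusion_spec:
  assumes AA: "augmented_algebra k A \<epsilon>" and M: "module k M"
  shows "k_linear k (rw_module k (augmentation_ideal k A \<epsilon>) M n) (rw_module k A M n) (rw_inclusion k A \<epsilon> M n)"
    and "s \<in> rw_indices (augmentation_ideal k A \<epsilon>) M n \<Longrightarrow>
      rw_inclusion k A \<epsilon> M n (rw_gen k (augmentation_ideal k A \<epsilon>) M n s) = rw_gen k A M n s"
proof -
  interpret k: cring k by (rule augmented_algebraD(1)[OF assms(1)])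
  interpret A: cring A by (rule augmented_algebraD(2)[OF assms(1)])
  interpret Am: module k A by (rule augmented_algebraD(3)[OF assms(1)])
  have A: "module k A" by (rule Am.module_axioms)
  let ?I = "augmentation_ideal k A \<epsilon>"
  note I = augmentation_ideal_module[OF AA]
  let ?N = "rw_module k ?I M n" and ?P = "rw_module k A M n"
  note N = rw_module_module[OF I M, of n] and P = rw_module_module[OF A M, of n]
  have tup: "as \<in> tuples A x" if "as \<in> tuples ?I x" for as x
    using that by (auto simp: tuples_def augmentation_ideal_simps)
  have lin: "k_linear k ?I ?P H" if "k_linear k A ?P H" for H
    using that unfolding k_linear_def by (simp add: augmentation_ideal_simps)
  have "rw_multilinear k ?I M x ?P (\<lambda>as m. rw_gen k A M n (fs, as, m))"
    if "fs \<in> nerve_strings n x 1" for x fs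
    using rw_gen_multilinear[OF A M that] tup lin unfolding rw_multilinear_def multilinear_def by blast
  then obtain F where F: "k_linear k ?N ?P F"
    "\<forall>(fs, as, m)\<in>rw_indices ?I M n. F (rw_gen k ?I M n (fs, as, m)) = rw_gen k A M n (fs, as, m)"
    using rw_lift[OF I M P, of n "\<lambda>fs as m. rw_gen k A M n (fs, as, m)"] by blast
  have "{(fs, as, m) \<in> rw_indices ?I M n. set as \<subseteq> carrier ?I} = rw_indices ?I M n"
    by (auto simp: rw_indices_def)
  then have gen: "generates k ?N (rw_gen k ?I M n ` rw_indices ?I M n)"
    using rw_gen_generates[OF I M generates_carrier, of n] by simp
  have val: "restrict F (carrier ?N) (rw_gen k ?I M n s) = rw_gen k A M n s"
    if s: "s \<in> rw_indices ?I M n" for s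
  proof -
    have "rw_gen k ?I M n s \<in> carrier ?N" using gen s unfolding generates_def by auto
    then show ?thesis using F(2) s by (cases s) auto
  qed
  have eq: "rw_inclusion k A \<epsilon> M n = restrict F (carrier ?N)"
    unfolding rw_inclusion_def Let_def
    by (rule linear_extension_eq[OF N P gen restrict_linear_maps[OF F(1) N]]) (rule val)
  show "k_linear k ?N ?P (rw_inclusion k A \<epsilon> M n)"
    unfolding eq by (rule k_linear_cong[OF F(1) N]) simp
  show "rw_inclusion k A \<epsilon> M n (rw_gen k ?I M n s) = rw_gen k A M n s" if "s \<in> rw_indices ?I M n"
    unfolding eq by (rule val[OF that])
qed

text \<open>
  All factors of a generator of the subcomplex are non-trivial, so there is nothing to prune.
\<close>

lemma pruning_gen_ideal:
  assumes "s \<in> rw_indices (augmentation_ideal k A \<epsilon>) M n"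
  shows "pruning_gen k A \<epsilon> M n s = rw_gen k (augmentation_ideal k A \<epsilon>) M n s"
proof -
  let ?I = "augmentation_ideal k A \<epsilon>"
  obtain fs as m where s: "s = (fs, as, m)" by (cases s)
  have fs: "fs \<in> nerve_strings n (length as) 1" and len: "1 \<le> length as" and as: "set as \<subseteq> carrier ?I"
    using assms by (auto simp: s rw_indices_def)
  have "as ! (l - 1) \<in> carrier ?I" if "l \<in> {1..length as}" for l
    using as nth_mem[of "l - 1" as] that by auto
  then have L: "{l \<in> {1..length as}. as ! (l - 1) \<in> carrier ?I} = {1..length as}" by blast
  have ne: "{1..length as} \<noteq> {}" using len by simp
  show ?thesis
    by (simp only: s pruning_gen_def Let_def prod.case L ne if_False prune_full[OF fs] subtuple_full)
qed

theorem theorem4p16: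
  fixes k :: "'k ring" and A :: "('k, 'a) module" and \<epsilon> :: "'a \<Rightarrow> 'k"
    and M :: "('k, 'm) module" and lact :: "'a \<Rightarrow> 'm \<Rightarrow> 'm" and ract :: "'m \<Rightarrow> 'a \<Rightarrow> 'm"
  assumes "augmented_algebra k A \<epsilon>"
    and "symmetric_bimodule k A M lact ract"
    and "flat_module k M"
  shows "chain_comp (rw_complex k A (augmentation_ideal k A \<epsilon>) M lact)
           (pruning_map k A \<epsilon> M) (rw_inclusion k A \<epsilon> M) =
         chain_id (rw_complex k A (augmentation_ideal k A \<epsilon>) M lact)"
proof
  fix n
  let ?I = "augmentation_ideal k A \<epsilon>"
  let ?N = "rw_module k ?I M n"
  have M: "module k M" using assms(3) by (simp add: flat_module_def)
  have I: "module k ?I" by (rule augmentation_ideal_module[OF assms(1)])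
  have N: "module k ?N" by (rule rw_module_module[OF I M])
  note P = pruning_map_spec[where n = n, OF assms(1) M] and i = rw_inclusion_spec[where n = n, OF assms(1) M]
  have gen: "generates k ?N (rw_gen k ?I M n ` rw_indices ?I M n)"
  proof -
    have "{(fs, as, m) \<in> rw_indices ?I M n. set as \<subseteq> carrier ?I} = rw_indices ?I M n"
      by (auto simp: rw_indices_def)
    then show ?thesis using rw_gen_generates[OF I M generates_carrier, of n] by simp
  qed
  have id: "k_linear k ?N ?N (\<lambda>X. X)" by (rule k_linearI) auto
  have "pruning_map k A \<epsilon> M n (rw_inclusion k A \<epsilon> M n X) = X" if X: "X \<in> carrier ?N" for X
  proof (rule k_linear_eqI[OF k_linear_comp[OF i(1) P(1)] id N N gen _ X])
    fix g assume "g \<in> rw_gen k ?I M n ` rw_indices ?I M n"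
    then obtain s where s: "s \<in> rw_indices ?I M n" "g = rw_gen k ?I M n s" by auto
    have "s \<in> basic_indices k A \<epsilon> M n"
      using s(1) by (auto simp: basic_indices_def rw_indices_def augmentation_ideal_simps)
    then show "pruning_map k A \<epsilon> M n (rw_inclusion k A \<epsilon> M n g) = g"
      using i(2)[OF s(1)] P(2) pruning_gen_ideal[OF s(1)] s(2) by simp
  qed
  then show "chain_comp (rw_complex k A ?I M lact) (pruning_map k A \<epsilon> M) (rw_inclusion k A \<epsilon> M) n
      = chain_id (rw_complex k A ?I M lact) n"
    by (auto simp: chain_comp_def chain_id_def rw_complex_def compose_def)
qed

end
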